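(* Let $p,q,r$ be positive integers such that one of $p,q,r$ is even, another is divisible by $3$, and the third is at least $7$. Then the triangle groups $\Delta(p,q,r)$ and $\Delta[p,q,r]$, together with their associated categories of oriented hypermaps of type $(p,q,r)$ and of all hypermaps of type $(p,q,r)$ respectively, have the countable automorphism realisation property.
   Context: "Countable" means finite or countably infinite. Triangle groups: the extended triangle group is $$\Delta[p,q,r]=\langle R_0,R_1,R_2\mid R_i^2=(R_1R_2)^p=(R_2R_0)^q=(R_0R_1)^r=1\rangle,$$ and the triangle group $\Delta(p,q,r)$ is its index-$2$ orientation-preserving subgroup $$\Delta(p,q,r)=\langle X,Y,Z\mid X^p=Y^q=Z^r=XYZ=1\rangle,$$ where $X=R_1R_2$, $Y=R_2R_0$, $Z=R_0R_1$. Permutational categories: the permutational category $\mathfrak C$ with parent group $\Gamma$ is (up to natural isomorphism) the category whose objects $\mathcal O$ are permutation representations $\theta:\Gamma\to{\rm Sym}(\Omega)$ on sets $\Omega$, and whose morphisms $\mathcal O_1\to\mathcal O_2$ are the functions $\Omega_1\to\Omega_2$ commuting with the actions of $\Gamma$. An object is connected if $\Gamma$ is transitive on $\Omega$. The automorphism group ${\rm Aut}_{\mathfrak C}(\mathcal O)$ is the group of all permutations of $\Omega$ commuting with the action of $\Gamma$. The category of oriented hypermaps of type $(p,q,r)$ is the permutational category with parent group $\Delta(p,q,r)$; the category of all hypermaps of type $(p,q,r)$ is the permutational category with parent group $\Delta[p,q,r]$. A category $\mathfrak C$ has the countable automorphism realisation property if every countable group $A$ is isomorphic to ${\rm Aut}_{\mathfrak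 C}(\mathcal O)$ for some connected object $\mathcal O$ of $\mathfrak C$. A group $\Gamma$ has the countable automorphism realisation property if every countable group $A$ is isomorphic to $N_\Gamma(M)/M$ for some subgroup $M\le\Gamma$. *)

theory Defs
  imports
    "HOL-Algebra.Algebra"
    "HOL-Library.Countable_Set"
    "HOL-Library.Multiset"
begin

section \<open>Group presentations\<close>

text \<open>
  A word over the generators \<open>'x\<close> is a list of letters; \<open>(x, True)\<close> stands for the generator \<open>x\<close>
  and \<open>(x, False)\<close> for its formal inverse. The group presented by a set of relators consists of the
  classes of words under insertion and deletion of relators and of pairs of mutually inverse letters.
  All elements of the type \<open>'x\<close> are generators.
\<close>

type_synonym 'x word = "('x \<times> bool) list"

inductive word_eq :: "'x word set \<Rightarrow> 'x word \<Rightarrow> 'x word \<Rightarrow> bool" for rels where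
  refl: "word_eq rels u u"
| sym: "word_eq rels u v \<Longrightarrow> word_eq rels v u"
| trans: "word_eq rels u v \<Longrightarrow> word_eq rels v w \<Longrightarrow> word_eq rels u w"
| cancel: "word_eq rels (u @ [(x, b), (x, \<not> b)] @ v) (u @ v)"
| relator: "r \<in> rels \<Longrightarrow> word_eq rels (u @ r @ v) (u @ v)"

definition word_class :: "'x word set \<Rightarrow> 'x word \<Rightarrow> 'x word set" where
  "word_class rels u = {v. word_eq rels u v}"

definition presented_group :: "'x word set \<Rightarrow> 'x word set monoid" where
  "presented_group rels =
     \<lparr>carrier = range (word_class rels),
      monoid.mult = (\<lambda>A B. \<Union>u\<in>A. \<Union>v\<in>B. word_class rels (u @ v)),
      one = word_class rels []\<rparr>"

lemma word_class_eq_iff: "word_class rels u = word_class rels v \<longleftrightarrow> word_eq rels u v"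
proof
  assume "word_class rels u = word_class rels v"
  moreover have "v \<in> word_class rels v"
    by (simp add: word_class_def word_eq.refl)
  ultimately have "v \<in> word_class rels u" by simp
  then show "word_eq rels u v" by (simp add: word_class_def)
next
  assume uv: "word_eq rels u v"
  show "word_class rels u = word_class rels v"
    unfolding word_class_def
    by (rule Collect_cong, rule iffI, erule word_eq.trans[OF word_eq.sym[OF uv]],
        erule word_eq.trans[OF uv])
qed

lemma word_eq_append_left: "word_eq rels u v \<Longrightarrow> word_eq rels (w @ u) (w @ v)"
proof (induction rule: word_eq.induct)
  case (cancel u x b v)
  show ?case using word_eq.cancel[of rels "w @ u" x b v] by simp
next
  case (relator r u v)
  then show ?case using word_eq.relator[of r rels "w @ u" v] by simp
next
  case (trans u v w')
  show ?case by (rule word_eq.trans[OF trans.IH])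
qed (simp_all add: word_eq.refl word_eq.sym)

lemma word_eq_append_right: "word_eq rels u v \<Longrightarrow> word_eq rels (u @ w) (v @ w)"
proof (induction rule: word_eq.induct)
  case (cancel u x b v)
  show ?case using word_eq.cancel[of rels u x b "v @ w"] by simp
next
  case (relator r u v)
  then show ?case using word_eq.relator[of r rels u "v @ w"] by simp
next
  case (trans u v w')
  show ?case by (rule word_eq.trans[OF trans.IH])
qed (simp_all add: word_eq.refl word_eq.sym)

lemma word_eq_append:
  "word_eq rels u u' \<Longrightarrow> word_eq rels v v' \<Longrightarrow> word_eq rels (u @ v) (u' @ v')"
  by (rule word_eq.trans[OF word_eq_append_right word_eq_append_left])

lemma mult_presented_group:
  "word_class rels u \<otimes>\<^bsub>presented_group rels\<^esub> word_class rels v = word_class rels (u @ v)"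
proof -
  have "word_class rels (u' @ v') = word_class rels (u @ v)"
    if "u' \<in> word_class rels u" "v' \<in> word_class rels v" for u' v'
  proof -
    have "word_eq rels u u'" "word_eq rels v v'"
      using that by (simp_all add: word_class_def)
    then have "word_eq rels (u @ v) (u' @ v')" by (rule word_eq_append)
    then show ?thesis unfolding word_class_eq_iff by (rule word_eq.sym)
  qed
  moreover have "u \<in> word_class rels u" "v \<in> word_class rels v"
    by (simp_all add: word_class_def word_eq.refl)
  ultimately have "(\<Union>u'\<in>word_class rels u. \<Union>v'\<in>word_class rels v. word_class rels (u' @ v')) =
      word_class rels (u @ v)"
    by blast
  then show ?thesis
    by (simp add: presented_group_def)
qed

definition inv_word :: "'x word \<Rightarrow> 'x word" where
  "inv_word w = rev (map (\<lambda>(x, b). (x, \<not> b)) w)"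

lemma word_eq_inv_word: "word_eq rels (inv_word w @ w) []"
proof (induction w)
  case Nil
  show ?case by (simp add: inv_word_def word_eq.refl)
next
  case (Cons l w)
  obtain x b where l: "l = (x, b)" by (cases l)
  have "word_eq rels (inv_word w @ [(x, \<not> b), (x, \<not> \<not> b)] @ w) (inv_word w @ w)"
    by (rule word_eq.cancel)
  then have "word_eq rels (inv_word (l # w) @ l # w) (inv_word w @ w)"
    by (simp add: inv_word_def l)
  then show ?case using Cons.IH by (rule word_eq.trans)
qed

lemma group_presented_group: "group (presented_group rels)"
proof (rule groupI)
  let ?G = "presented_group rels"
  have carrier: "carrier ?G = range (word_class rels)" and one: "\<one>\<^bsub>?G\<^esub> = word_class rels []"
    by (simp_all add: presented_group_def)
  show "\<one>\<^bsub>?G\<^esub> \<in> carrier ?G"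
    by (simp add: carrier one)
  show "a \<otimes>\<^bsub>?G\<^esub> b \<in> carrier ?G" if "a \<in> carrier ?G" "b \<in> carrier ?G" for a b
    using that by (auto simp: carrier mult_presented_group)
  show "a \<otimes>\<^bsub>?G\<^esub> b \<otimes>\<^bsub>?G\<^esub> c = a \<otimes>\<^bsub>?G\<^esub> (b \<otimes>\<^bsub>?G\<^esub> c)"
    if "a \<in> carrier ?G" "b \<in> carrier ?G" "c \<in> carrier ?G" for a b c
    using that by (auto simp: carrier mult_presented_group)
  show "\<one>\<^bsub>?G\<^esub> \<otimes>\<^bsub>?G\<^esub> a = a" if "a \<in> carrier ?G" for a
    using that by (auto simp: carrier one mult_presented_group)
  show "\<exists>b\<in>carrier ?G. b \<otimes>\<^bsub>?G\<^esub> a = \<one>\<^bsub>?G\<^esub>" if a: "a \<in> carrier ?G" for a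
  proof -
    obtain w where w: "a = word_class rels w"
      using a by (auto simp: carrier)
    have "word_class rels (inv_word w) \<otimes>\<^bsub>?G\<^esub> a = \<one>\<^bsub>?G\<^esub>"
      by (simp add: w one mult_presented_group word_class_eq_iff word_eq_inv_word)
    then show ?thesis by (auto simp: carrier)
  qed
qed

section \<open>Triangle groups\<close>

abbreviation gen :: "'x \<Rightarrow> 'x word" where
  "gen x \<equiv> [(x, True)]"

definition word_power :: "'x word \<Rightarrow> nat \<Rightarrow> 'x word" where
  "word_power w n = concat (replicate n w)"

datatype reflection = Refl0 | Refl1 | Refl2

definition extended_triangle_group :: "nat \<Rightarrow> nat \<Rightarrow> nat \<Rightarrow> reflection word set monoid" where
  "extended_triangle_group p q r = presented_group
     {word_power (gen Refl0) 2, word_power (gen Refl1) 2, word_power (gen Refl2) 2,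
      word_power (gen Refl1 @ gen Refl2) p,
      word_power (gen Refl2 @ gen Refl0) q,
      word_power (gen Refl0 @ gen Refl1) r}"

text \<open>
  Under \<open>X = R\<^sub>1R\<^sub>2\<close>, \<open>Y = R\<^sub>2R\<^sub>0\<close>, \<open>Z = R\<^sub>0R\<^sub>1\<close> this is a presentation of the orientation-preserving
  subgroup of index 2 in the extended triangle group.
\<close>

datatype rotation = RotX | RotY | RotZ

definition triangle_group :: "nat \<Rightarrow> nat \<Rightarrow> nat \<Rightarrow> rotation word set monoid" where
  "triangle_group p q r = presented_group
     {word_power (gen RotX) p, word_power (gen RotY) q, word_power (gen RotZ) r,
      gen RotX @ gen RotY @ gen RotZ}"

section \<open>Permutational categories\<close>

text \<open>
  A permutational category is determined by its parent group. Its objects are permutation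
  representations and its morphisms the equivariant functions, taken to be extensional
  (\<open>undefined\<close> outside the domain) like the elements of \<^const>\<open>BijGroup\<close>.
\<close>

datatype 'g perm_category = Perm_Category (parent_group: "'g monoid")

record ('g, 'b) perm_rep =
  points :: "'b set"
  act :: "'g \<Rightarrow> 'b \<Rightarrow> 'b"

definition objects :: "'g perm_category \<Rightarrow> ('g, 'b) perm_rep set" where
  "objects C = {S. group_action (parent_group C) (points S) (act S)}"

definition equivariant_maps ::
  "'g perm_category \<Rightarrow> ('g, 'b) perm_rep \<Rightarrow> ('g, 'c) perm_rep \<Rightarrow> ('b \<Rightarrow> 'c) set" where
  "equivariant_maps C S T =
     {f \<in> points S \<rightarrow>\<^sub>E points T.
        \<forall>g\<in>carrier (parent_group C). \<forall>x\<in>points S. f (act S g x) = act T g (f x)}"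

text \<open>The empty representation is not regarded as connected.\<close>

definition connected_object :: "'g perm_category \<Rightarrow> ('g, 'b) perm_rep \<Rightarrow> bool" where
  "connected_object C S \<longleftrightarrow>
     points S \<noteq> {} \<and> transitive_action (parent_group C) (points S) (act S)"

definition automorphism_group :: "'g perm_category \<Rightarrow> ('g, 'b) perm_rep \<Rightarrow> ('b \<Rightarrow> 'b) monoid" where
  "automorphism_group C S =
     (BijGroup (points S))\<lparr>carrier := Bij (points S) \<inter> equivariant_maps C S S\<rparr>"

definition oriented_hypermaps :: "nat \<Rightarrow> nat \<Rightarrow> nat \<Rightarrow> rotation word set perm_category" where
  "oriented_hypermaps p q r = Perm_Category (triangle_group p q r)"

definition all_hypermaps :: "nat \<Rightarrow> nat \<Rightarrow> nat \<Rightarrow> reflection word set perm_category" where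
  "all_hypermaps p q r = Perm_Category (extended_triangle_group p q r)"

section \<open>The countable automorphism realisation property\<close>

text \<open>
  A definition cannot quantify over types, so the type \<open>'a\<close> carrying the countable groups to be
  realised is a parameter; a result proved for a type variable \<open>'a\<close> covers all countable groups.
\<close>

definition group_countable_realisation :: "'a itself \<Rightarrow> 'g monoid \<Rightarrow> bool" where
  "group_countable_realisation _ G \<longleftrightarrow>
     (\<forall>A :: 'a monoid. group A \<and> countable (carrier A) \<longrightarrow>
        (\<exists>M. subgroup M G \<and> A \<cong> G\<lparr>carrier := normalizer G M\<rparr> Mod M))"

text \<open>
  Taking the points of the object from \<open>'g set\<close> is no restriction: a transitive representation of
  a group on elements of \<open>'g\<close> is isomorphic to one on the cosets of a point stabiliser.
\<close>

definition category_countable_realisation :: "'a itself \<Rightarrow> 'g perm_category \<Rightarrow> bool" where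
  "category_countable_realisation _ C \<longleftrightarrow>
     (\<forall>A :: 'a monoid. group A \<and> countable (carrier A) \<longrightarrow>
        (\<exists>S :: ('g, 'g set) perm_rep.
           S \<in> objects C \<and> connected_object C S \<and> A \<cong> automorphism_group C S))"

end

theory Submission
  imports Defs
begin

text \<open>
  A transitive permutation representation of a group \<open>G\<close> with point stabiliser \<open>M\<close> has automorphism group
  \<open>N\<^sub>G(M)/M\<close> (\<open>automorphism_group_iso_normalizer_quotient\<close>). So both forms of the property ask, for each
  countable group \<open>A\<close>, for a transitive representation whose centraliser is isomorphic to \<open>A\<close>. As one
  period is even, another divisible by 3 and the third some \<open>n \<ge> 7\<close>, it suffices to represent
  \<open>\<Delta>(2,3,n)\<close>. This means to find permutations \<open>x\<close> and \<open>y\<close> with \<open>x\<^sup>2 = y\<^sup>3 = (xy)\<^sup>n = 1\<close>. They come from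
  any oriented map with vertices of degree 3 or 1 whose faces are \<open>n\<close>-gons: \<open>x\<close> reverses the darts and \<open>y\<close>
  turns about the vertices. Its automorphism group has to be \<open>A\<close>.

  Without the condition on faces this is easy. Take a trivalent graph with one leaf and with
  loops labelled by all elements of \<open>A\<close>, and its connected covering with group \<open>A\<close>, in which each sheet has one
  leaf. The leaves are the fixed points of \<open>y\<close>, so any automorphism takes a leaf
  to a leaf and agrees there with an element of \<open>A\<close>; by connectedness it is that element.

  The faces are repaired by going outwards instead of closing anything up. The graph, embedded as the core
  of an oriented surface with boundary, is surrounded by layer after layer of \<open>n\<close>-gons,
  as in the hyperbolic tessellation by \<open>n\<close>-gons meeting three at a vertex. Each new face needs room for at
  least one new outgoing edge, and for \<open>n \<ge> 7\<close> there is room at every stage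
  (\<open>face_closes\<close>, \<open>along_funpow_n\<close>). The construction is canonical, so \<open>A\<close> still acts, and it creates no new
  vertices of degree 1, so the leaves are still recognised.

  For the extended triangle group, two mirror copies of the map are exchanged by the reflections. Automorphisms
  that preserve the copies are those of the map. One that exchanged them would be an isomorphism of the map
  with its mirror image; none exists, because next to the leaf the graph has a second mark, an edge
  reversed onto itself, on one side only (\<open>no_mirror\<close>).
\<close>

section \<open>Automorphism groups as normaliser quotients\<close>

text \<open>
  An infinite subgroup may be mapped properly into itself by a conjugation, so membership in the
  normaliser has to be an equivalence here, not an implication.
\<close>

lemma (in group) mem_normalizer_iff:
  assumes M: "subgroup M G" and g: "g \<in> carrier G"
  shows "g \<in> normalizer G M \<longleftrightarrow> (\<forall>m\<in>carrier G. m \<in> M \<longleftrightarrow> g \<otimes> m \<otimes> inv g \<in> M)"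
proof -
  have sub: "M \<subseteq> carrier G" using M by (rule subgroup.subset)
  have "g <# M #> inv g = {g \<otimes> m \<otimes> inv g |m. m \<in> M}"
    by (auto simp: l_coset_def r_coset_def)
  then have norm: "g \<in> normalizer G M \<longleftrightarrow> {g \<otimes> m \<otimes> inv g |m. m \<in> M} = M"
    using g sub by (simp add: normalizer_def stabilizer_def)
  have inj: "m = m'" if "m \<in> carrier G" "m' \<in> carrier G" "g \<otimes> m \<otimes> inv g = g \<otimes> m' \<otimes> inv g" for m m'
    using that g by (simp add: m_assoc)
  have surj: "g \<otimes> (inv g \<otimes> m \<otimes> g) \<otimes> inv g = m" if "m \<in> carrier G" for m
    using that g by (simp add: m_assoc) (simp flip: m_assoc)
  show ?thesis
  proof (rule iffI)
    assume L: "g \<in> normalizer G M"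
    show "\<forall>m\<in>carrier G. m \<in> M \<longleftrightarrow> g \<otimes> m \<otimes> inv g \<in> M"
    proof (intro ballI iffI)
      fix m assume "m \<in> carrier G" "m \<in> M"
      then show "g \<otimes> m \<otimes> inv g \<in> M" using L norm by blast
    next
      fix m assume m: "m \<in> carrier G" "g \<otimes> m \<otimes> inv g \<in> M"
      then obtain m' where "m' \<in> M" "g \<otimes> m \<otimes> inv g = g \<otimes> m' \<otimes> inv g"
        using L norm by blast
      then show "m \<in> M" using inj[of m m'] m sub by auto
    qed
  next
    assume R: "\<forall>m\<in>carrier G. m \<in> M \<longleftrightarrow> g \<otimes> m \<otimes> inv g \<in> M"
    have "m \<in> {g \<otimes> m \<otimes> inv g |m. m \<in> M}" if m: "m \<in> M" for m
    proof -
      have mc: "m \<in> carrier G" using m sub by blast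
      have "inv g \<otimes> m \<otimes> g \<in> M" using R surj[OF mc] m mc g by (metis inv_closed m_closed)
      then show ?thesis using surj[OF mc] by force
    qed
    moreover have "{g \<otimes> m \<otimes> inv g |m. m \<in> M} \<subseteq> M" using R sub by auto
    ultimately show "g \<in> normalizer G M" unfolding norm by blast
  qed
qed

lemma automorphism_group_mult:
  "f \<in> carrier (automorphism_group C S) \<Longrightarrow> f' \<in> carrier (automorphism_group C S) \<Longrightarrow>
    f \<otimes>\<^bsub>automorphism_group C S\<^esub> f' = compose (points S) f f'"
  by (simp add: automorphism_group_def BijGroup_def)

lemma automorphism_group_carrier:
  "carrier (automorphism_group C S) = Bij (points S) \<inter> equivariant_maps C S S"
  by (simp add: automorphism_group_def)

lemma group_automorphism_group:
  assumes "group_action G E \<phi>"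
  shows "group (automorphism_group (Perm_Category G) \<lparr>points = E, act = \<phi>\<rparr>)" (is "group ?Aut")
proof -
  interpret group_action G E \<phi> by fact
  have closed: "\<phi> g \<omega> \<in> E" if "g \<in> carrier G" "\<omega> \<in> E" for g \<omega>
    using element_image[OF that] by blast
  let ?C = "Bij E \<inter> equivariant_maps (Perm_Category G) \<lparr>points = E, act = \<phi>\<rparr> \<lparr>points = E, act = \<phi>\<rparr>"
  have mem: "f \<in> ?C \<longleftrightarrow> f \<in> Bij E \<and> (\<forall>g\<in>carrier G. \<forall>\<omega>\<in>E. f (\<phi> g \<omega>) = \<phi> g (f \<omega>))" for f
    by (auto simp: equivariant_maps_def PiE_def Bij_def dest: bij_betwE)
  have "subgroup ?C (BijGroup E)"
  proof (rule group.subgroupI[OF group_BijGroup])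
    show "?C \<subseteq> carrier (BijGroup E)" by (auto simp: BijGroup_def)
    have "(\<lambda>\<omega>\<in>E. \<omega>) \<in> ?C" unfolding mem by (simp add: id_Bij closed)
    then show "?C \<noteq> {}" by blast
  next
    fix f assume f: "f \<in> ?C"
    then have fB: "f \<in> Bij E" and comm: "\<forall>g\<in>carrier G. \<forall>\<omega>\<in>E. f (\<phi> g \<omega>) = \<phi> g (f \<omega>)"
      unfolding mem by auto
    have bij: "bij_betw f E E" using fB by (simp add: Bij_def)
    have "inv_into E f (\<phi> g \<omega>) = \<phi> g (inv_into E f \<omega>)" if g: "g \<in> carrier G" and \<omega>: "\<omega> \<in> E" for g \<omega>
    proof (rule inv_into_f_eq)
      have in_E: "inv_into E f \<omega> \<in> E" by (rule Bij_inv_into_mem[OF fB \<omega>])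
      show "inj_on f E" using bij by (rule bij_betw_imp_inj_on)
      show "\<phi> g (inv_into E f \<omega>) \<in> E" using closed[OF g in_E] .
      show "f (\<phi> g (inv_into E f \<omega>)) = \<phi> g \<omega>"
        using comm g in_E bij \<omega> by (simp add: bij_betw_inv_into_right)
    qed
    then show "inv\<^bsub>BijGroup E\<^esub> f \<in> ?C"
      unfolding mem inv_BijGroup[OF fB] using closed fB by (simp add: restrict_inv_into_Bij Bij_inv_into_mem)
  next
    fix f f' assume "f \<in> ?C" "f' \<in> ?C"
    then have f: "f \<in> Bij E" "\<forall>g\<in>carrier G. \<forall>\<omega>\<in>E. f (\<phi> g \<omega>) = \<phi> g (f \<omega>)"
      and f': "f' \<in> Bij E" "\<forall>g\<in>carrier G. \<forall>\<omega>\<in>E. f' (\<phi> g \<omega>) = \<phi> g (f' \<omega>)"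
      unfolding mem by auto
    have "f' \<omega> \<in> E" if "\<omega> \<in> E" for \<omega> using Bij_imp_funcset[OF f'(1)] that by blast
    then show "f \<otimes>\<^bsub>BijGroup E\<^esub> f' \<in> ?C"
      unfolding mem using f f' closed by (simp add: BijGroup_def compose_Bij compose_eq)
  qed
  from group.subgroup_imp_group[OF group_BijGroup this]
  show ?thesis by (simp add: automorphism_group_def)
qed

context transitive_action
begin

lemma is_group: "group G"
  using group_hom group_hom.axioms(1) by blast

lemma act_one: "\<omega> \<in> E \<Longrightarrow> \<phi> \<one> \<omega> = \<omega>"
  using id_eq_one by (metis restrict_apply')

lemma act_inv: "g \<in> carrier G \<Longrightarrow> \<omega> \<in> E \<Longrightarrow> \<phi> g (\<phi> (inv g) \<omega>) = \<omega> \<and> \<phi> (inv g) (\<phi> g \<omega>) = \<omega>"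
  using is_group composition_rule act_one
  by (metis group.inv_closed group.l_inv group.r_inv)

end

text \<open>
  An automorphism \<open>f\<close> of a transitive object is determined by where it sends a base point \<open>s\<close>. As
  \<open>f\<close> preserves stabilisers, the elements moving \<open>f s\<close> to \<open>s\<close> normalise the stabiliser \<open>M\<close>, and they
  form one coset of it. Taking the elements that move \<open>f s\<close> back to \<open>s\<close>, rather than \<open>s\<close> to \<open>f s\<close>,
  makes the correspondence a homomorphism and not an antihomomorphism.
\<close>

theorem automorphism_group_iso_normalizer_quotient:
  fixes G :: "'g monoid" (structure)
  assumes "transitive_action G E \<phi>" and s: "s \<in> E"
  defines "M \<equiv> stabilizer G \<phi> s"
  shows "automorphism_group (Perm_Category G) \<lparr>points = E, act = \<phi>\<rparr>
    \<cong> G\<lparr>carrier := normalizer G M\<rparr> Mod M"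
proof -
  interpret transitive_action G E \<phi> by fact
  interpret group G by (rule is_group)
  let ?Aut = "automorphism_group (Perm_Category G) \<lparr>points = E, act = \<phi>\<rparr>"
  let ?N = "G\<lparr>carrier := normalizer G M\<rparr>"
  have M: "subgroup M G" unfolding M_def by (rule stabilizer_subgroup[OF s])
  have M_iff: "m \<in> M \<longleftrightarrow> m \<in> carrier G \<and> \<phi> m s = s" for m
    by (auto simp: M_def stabilizer_def)
  have N_sub: "normalizer G M \<subseteq> carrier G"
    using normalizer_imp_subgroup[OF subgroup.subset[OF M]] by (rule subgroup.subset)
  have closed: "\<phi> g \<omega> \<in> E" if "g \<in> carrier G" "\<omega> \<in> E" for g \<omega>
    using element_image[OF that] by blast
  have Aut: "f \<in> carrier ?Aut \<longleftrightarrow> f \<in> extensional E \<and> bij_betw f E E \<and>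
      (\<forall>g\<in>carrier G. \<forall>\<omega>\<in>E. f (\<phi> g \<omega>) = \<phi> g (f \<omega>))" for f
    by (auto simp: automorphism_group_carrier Bij_def equivariant_maps_def PiE_def dest: bij_betwE)
  define \<Theta> where "\<Theta> f = {g \<in> carrier G. \<phi> g (f s) = s}" for f
  have coset: "\<Theta> f = M #> g" if fE: "f s \<in> E" and g: "g \<in> carrier G" "\<phi> g (f s) = s" for f g
  proof -
    have "h \<in> M #> g" if h: "h \<in> carrier G" "\<phi> h (f s) = s" for h
    proof -
      have "\<phi> (h \<otimes> inv g) s = s"
        using h g fE s act_inv composition_rule by (metis inv_closed)
      then have "h \<otimes> inv g \<in> M" using h g by (simp add: M_iff)
      moreover have "h = h \<otimes> inv g \<otimes> g" using h g by (simp add: m_assoc)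
      ultimately show ?thesis unfolding r_coset_def by blast
    qed
    moreover have "m \<otimes> g \<in> carrier G \<and> \<phi> (m \<otimes> g) (f s) = s" if "m \<in> M" for m
      using that g fE by (simp add: M_iff composition_rule)
    ultimately show ?thesis unfolding \<Theta>_def r_coset_def by blast
  qed
  have in_N: "g \<in> normalizer G M" if f: "f \<in> carrier ?Aut" and g: "g \<in> carrier G" "\<phi> g (f s) = s" for f g
  proof -
    have fE: "f s \<in> E" and finj: "inj_on f E" and
      fcomm: "\<And>h \<omega>. h \<in> carrier G \<Longrightarrow> \<omega> \<in> E \<Longrightarrow> f (\<phi> h \<omega>) = \<phi> h (f \<omega>)"
      using f s unfolding Aut bij_betw_def by auto
    have "m \<in> M \<longleftrightarrow> g \<otimes> m \<otimes> inv g \<in> M" if m: "m \<in> carrier G" for m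
    proof -
      have "g \<otimes> m \<otimes> inv g \<in> M \<longleftrightarrow> \<phi> g (\<phi> m (\<phi> (inv g) s)) = s"
        using g m s closed by (simp add: M_iff composition_rule)
      also have "\<phi> (inv g) s = f s" using g fE act_inv by metis
      also have "\<phi> g (\<phi> m (f s)) = s \<longleftrightarrow> \<phi> m (f s) = f s"
        using g m fE act_inv closed by metis
      also have "\<dots> \<longleftrightarrow> f (\<phi> m s) = f s" using fcomm m s by simp
      also have "\<dots> \<longleftrightarrow> \<phi> m s = s" using finj closed m s by (simp add: inj_on_eq_iff)
      finally show ?thesis using m by (simp add: M_iff)
    qed
    then show ?thesis using mem_normalizer_iff[OF M g(1)] by blast
  qed
  have move: "\<exists>g\<in>carrier G. \<phi> g (f s) = s" if "f \<in> carrier ?Aut" for f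
    using that s unique_orbit[of "f s" s] unfolding Aut by (auto dest: bij_betwE)
  have fE: "f s \<in> E" if "f \<in> carrier ?Aut" for f
    using that s unfolding Aut by (auto dest: bij_betwE)
  have rc: "M #>\<^bsub>?N\<^esub> g = M #> g" for g by (simp add: r_coset_def)
  have "\<Theta> \<in> iso ?Aut (?N Mod M)"
  proof (rule isoI)
    show "\<Theta> \<in> hom ?Aut (?N Mod M)"
    proof (rule homI)
      fix f assume f: "f \<in> carrier ?Aut"
      then obtain g where g: "g \<in> carrier G" "\<phi> g (f s) = s" using move by blast
      show "\<Theta> f \<in> carrier (?N Mod M)"
        using coset[of f g, OF fE[OF f] g] in_N[of f g, OF f g] by (auto simp: carrier_FactGroup rc)
    next
      fix f f' assume f: "f \<in> carrier ?Aut" and f': "f' \<in> carrier ?Aut"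
      then obtain g g' where g: "g \<in> carrier G" "\<phi> g (f s) = s" and g': "g' \<in> carrier G" "\<phi> g' (f' s) = s"
        using move by metis
      have comm: "f (\<phi> h \<omega>) = \<phi> h (f \<omega>)" if "h \<in> carrier G" "\<omega> \<in> E" for h \<omega>
        using f that unfolding Aut by blast
      have ff': "f (f' s) \<in> E" using f fE[OF f'] unfolding Aut by (auto dest: bij_betwE)
      have "\<phi> (g \<otimes> g') (f (f' s)) = \<phi> g (f (\<phi> g' (f' s)))"
        using comm[OF g'(1) fE[OF f']] g(1) g'(1) ff' by (simp add: composition_rule)
      then have gg': "\<phi> (g \<otimes> g') (f (f' s)) = s" using g g' by simp
      have "\<Theta> (f \<otimes>\<^bsub>?Aut\<^esub> f') = \<Theta> (f \<circ> f')"
        using f f' s by (simp add: automorphism_group_mult compose_eq \<Theta>_def)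
      also have "\<dots> = M #> (g \<otimes> g')"
        using coset[of "f \<circ> f'" "g \<otimes> g'"] ff' g g' gg' by simp
      also have "\<dots> = (M #> g) <#>\<^bsub>?N\<^esub> (M #> g')"
      proof -
        have sub: "M \<subseteq> carrier G" by (rule subgroup.subset[OF M])
        have gN: "g \<in> normalizer G M" by (rule in_N[of f g, OF f g])
        have "(M #> g) <#>\<^bsub>?N\<^esub> (M #> g') \<subseteq> M #> (g \<otimes> g')"
        proof
          fix u assume "u \<in> (M #> g) <#>\<^bsub>?N\<^esub> (M #> g')"
          then obtain m m' where m: "m \<in> M" "m' \<in> M" and u: "u = m \<otimes> g \<otimes> (m' \<otimes> g')"
            by (auto simp: set_mult_def r_coset_def)
          have mc: "m \<in> carrier G" "m' \<in> carrier G" using m sub by auto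
          have "g \<otimes> m' \<otimes> inv g \<in> M"
            using gN mem_normalizer_iff[OF M g(1)] mc m by blast
          then have "m \<otimes> (g \<otimes> m' \<otimes> inv g) \<in> M" using m subgroup.m_closed[OF M] by blast
          moreover have "u = m \<otimes> (g \<otimes> m' \<otimes> inv g) \<otimes> (g \<otimes> g')"
          proof -
            have "inv g \<otimes> (g \<otimes> g') = g'" using g g' by (simp flip: m_assoc)
            then show ?thesis using u mc g g' by (simp add: m_assoc)
          qed
          ultimately show "u \<in> M #> (g \<otimes> g')" unfolding r_coset_def by blast
        qed
        moreover have "M #> (g \<otimes> g') \<subseteq> (M #> g) <#>\<^bsub>?N\<^esub> (M #> g')"
        proof
          fix u assume "u \<in> M #> (g \<otimes> g')"
          then obtain m where m: "m \<in> M" "u = m \<otimes> (g \<otimes> g')" unfolding r_coset_def by blast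
          then have "u = (m \<otimes> g) \<otimes> (\<one> \<otimes> g')" using sub g g' by (auto simp: m_assoc)
          then show "u \<in> (M #> g) <#>\<^bsub>?N\<^esub> (M #> g')"
            using m subgroup.one_closed[OF M] unfolding set_mult_def r_coset_def by auto
        qed
        ultimately show ?thesis by blast
      qed
      also have "\<dots> = \<Theta> f \<otimes>\<^bsub>?N Mod M\<^esub> \<Theta> f'"
        using coset[of f g, OF fE[OF f] g] coset[of f' g', OF fE[OF f'] g'] by simp
      finally show "\<Theta> (f \<otimes>\<^bsub>?Aut\<^esub> f') = \<Theta> f \<otimes>\<^bsub>?N Mod M\<^esub> \<Theta> f'" .
    qed
    show "bij_betw \<Theta> (carrier ?Aut) (carrier (?N Mod M))"
      unfolding bij_betw_def
    proof
      show "inj_on \<Theta> (carrier ?Aut)"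
      proof (rule inj_onI)
        fix f f' assume f: "f \<in> carrier ?Aut" and f': "f' \<in> carrier ?Aut" and eq: "\<Theta> f = \<Theta> f'"
        obtain g where g: "g \<in> carrier G" "\<phi> g (f s) = s" using move[OF f] by blast
        then have "g \<in> \<Theta> f'" using eq by (auto simp: \<Theta>_def)
        then have "\<phi> g (f s) = \<phi> g (f' s)" using g by (simp add: \<Theta>_def)
        then have fs: "f s = f' s" using g fE[OF f] fE[OF f'] act_inv by metis
        show "f = f'"
        proof (rule extensionalityI[of _ E])
          fix \<omega> assume "\<omega> \<in> E"
          then obtain h where "h \<in> carrier G" "\<omega> = \<phi> h s" using unique_orbit[OF s] by blast
          then show "f \<omega> = f' \<omega>" using f f' s fs unfolding Aut by simp
        qed (use f f' in \<open>simp_all add: Aut\<close>)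
      qed
      show "\<Theta> ` carrier ?Aut = carrier (?N Mod M)"
      proof (rule subset_antisym)
        show "\<Theta> ` carrier ?Aut \<subseteq> carrier (?N Mod M)"
        proof (rule image_subsetI)
          fix f assume f: "f \<in> carrier ?Aut"
          then obtain g where g: "g \<in> carrier G" "\<phi> g (f s) = s" using move by blast
          show "\<Theta> f \<in> carrier (?N Mod M)"
            using coset[of f g, OF fE[OF f] g] in_N[of f g, OF f g] by (auto simp: carrier_FactGroup rc)
        qed
        show "carrier (?N Mod M) \<subseteq> \<Theta> ` carrier ?Aut"
        proof
          fix K assume "K \<in> carrier (?N Mod M)"
          then obtain g where gN: "g \<in> normalizer G M" and K: "K = M #> g"
            by (auto simp: carrier_FactGroup rc)
          have g: "g \<in> carrier G" using gN N_sub by blast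
          \<comment> \<open>\<open>s\<close> and \<open>g\<inverse> s\<close> have the same stabiliser, so \<open>h s \<mapsto> h g\<inverse> s\<close> is a well-defined injection.\<close>
          have key: "\<phi> h (\<phi> (inv g) s) = \<phi> h' (\<phi> (inv g) s) \<longleftrightarrow> \<phi> h s = \<phi> h' s"
            if h: "h \<in> carrier G" "h' \<in> carrier G" for h h'
          proof -
            let ?m = "inv h' \<otimes> h"
            have eq: "\<phi> ?m \<omega> = \<omega> \<longleftrightarrow> \<phi> h \<omega> = \<phi> h' \<omega>" if "\<omega> \<in> E" for \<omega>
              using h that closed act_inv by (metis composition_rule inv_closed)
            have m: "?m \<in> carrier G" using h by simp
            have t: "\<phi> (inv g) s \<in> E" using closed g s by simp
            have "?m \<in> M \<longleftrightarrow> g \<otimes> ?m \<otimes> inv g \<in> M"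
              using gN mem_normalizer_iff[OF M g] m by blast
            also have "\<dots> \<longleftrightarrow> \<phi> g (\<phi> ?m (\<phi> (inv g) s)) = s"
              using g m s t by (simp add: M_iff composition_rule closed)
            also have "\<dots> \<longleftrightarrow> \<phi> ?m (\<phi> (inv g) s) = \<phi> (inv g) s"
              using g t m s closed act_inv by metis
            finally show ?thesis using eq[OF s] eq[OF t] m by (simp add: M_iff)
          qed
          define f where "f = (\<lambda>\<omega>\<in>E. \<phi> (SOME h. h \<in> carrier G \<and> \<phi> h s = \<omega>) (\<phi> (inv g) s))"
          have f: "f (\<phi> h s) = \<phi> h (\<phi> (inv g) s)" if h: "h \<in> carrier G" for h
          proof -
            let ?h = "SOME k. k \<in> carrier G \<and> \<phi> k s = \<phi> h s"
            have "?h \<in> carrier G \<and> \<phi> ?h s = \<phi> h s" by (rule someI[of _ h]) (simp add: h)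
            then show ?thesis using key[of ?h h] h s closed by (simp add: f_def)
          qed
          have t: "\<phi> (inv g) s \<in> E" using closed g s by simp
          have orb: "\<exists>h\<in>carrier G. \<omega> = \<phi> h s" "\<exists>h\<in>carrier G. \<omega> = \<phi> h (\<phi> (inv g) s)" if "\<omega> \<in> E" for \<omega>
            by (metis unique_orbit[OF s that]) (metis unique_orbit[OF t that])
          have "bij_betw f E E"
          proof (rule bij_betw_imageI)
            show "inj_on f E"
            proof (rule inj_onI)
              fix \<omega> \<omega>' assume "\<omega> \<in> E" "\<omega>' \<in> E" and eq: "f \<omega> = f \<omega>'"
              then obtain h h' where h: "h \<in> carrier G" "\<omega> = \<phi> h s" "h' \<in> carrier G" "\<omega>' = \<phi> h' s"
                using orb(1) by metis
              then show "\<omega> = \<omega>'" using eq f key by metis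
            qed
            show "f ` E = E"
            proof
              show "f ` E \<subseteq> E" using orb(1) f closed t by (metis image_subsetI)
              show "E \<subseteq> f ` E" using orb(2) f closed s by (metis image_eqI subsetI)
            qed
          qed
          moreover have "f (\<phi> h \<omega>) = \<phi> h (f \<omega>)" if h: "h \<in> carrier G" and \<omega>: "\<omega> \<in> E" for h \<omega>
          proof -
            obtain k where k: "k \<in> carrier G" "\<omega> = \<phi> k s" using orb(1)[OF \<omega>] by blast
            then have "f (\<phi> h \<omega>) = f (\<phi> (h \<otimes> k) s)" using h s by (simp add: composition_rule)
            also have "\<dots> = \<phi> (h \<otimes> k) (\<phi> (inv g) s)" using h k by (simp add: f)
            also have "\<dots> = \<phi> h (f \<omega>)" using h k t by (simp add: composition_rule f)
            finally show ?thesis .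
          qed
          ultimately have fA: "f \<in> carrier ?Aut" unfolding Aut by (simp add: f_def)
          have "f s = \<phi> (inv g) s" using f[of \<one>] act_one s t by simp
          then have "\<phi> g (f s) = s" using act_inv g s by simp
          then have "\<Theta> f = K" using coset[of f g, OF fE[OF fA] g] K by simp
          then show "K \<in> \<Theta> ` carrier ?Aut" using fA by blast
        qed
      qed
    qed
  qed
  then show ?thesis by (auto simp: is_iso_def)
qed

lemma (in group) left_coset_action:
  assumes M: "subgroup M G"
  defines "E \<equiv> {l_coset G g M |g. g \<in> carrier G}"
  defines "\<phi> \<equiv> \<lambda>g. \<lambda>C\<in>E. l_coset G g C"
  shows "transitive_action G E \<phi>" "M \<in> E" "stabilizer G \<phi> M = M"
proof -
  have sub: "M \<subseteq> carrier G" by (rule subgroup.subset[OF M])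
  have \<phi>: "\<phi> g (l_coset G h M) = l_coset G (g \<otimes> h) M" if "g \<in> carrier G" "h \<in> carrier G" for g h
  proof -
    have "l_coset G h M \<in> E" using that by (auto simp: E_def)
    then show ?thesis using that sub by (simp add: \<phi>_def lcos_m_assoc)
  qed
  have closed: "\<phi> g C \<in> E" if "g \<in> carrier G" "C \<in> E" for g C
  proof -
    from that(2) obtain h where h: "h \<in> carrier G" "C = l_coset G h M" by (auto simp: E_def)
    then show ?thesis using \<phi>[OF that(1) h(1)] that(1) by (auto simp: E_def)
  qed
  have mult: "\<phi> (g \<otimes> h) C = \<phi> g (\<phi> h C)" if "g \<in> carrier G" "h \<in> carrier G" "C \<in> E" for g h C
  proof -
    from that(3) obtain k where "k \<in> carrier G" "C = l_coset G k M" by (auto simp: E_def)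
    then show ?thesis using that by (simp add: \<phi> m_assoc)
  qed
  have one: "\<phi> \<one> C = C" if "C \<in> E" for C
  proof -
    from that obtain k where "k \<in> carrier G" "C = l_coset G k M" by (auto simp: E_def)
    then show ?thesis by (simp add: \<phi>)
  qed
  have bij: "\<phi> g \<in> Bij E" if g: "g \<in> carrier G" for g
  proof -
    have "bij_betw (\<phi> g) E E"
      by (rule bij_betw_byWitness[of _ "\<phi> (inv g)"])
        (use g in \<open>auto simp: closed one simp flip: mult\<close>)
    then show ?thesis by (simp add: Bij_def \<phi>_def)
  qed
  have "\<phi> \<in> hom G (BijGroup E)"
  proof (rule homI)
    show "\<phi> g \<in> carrier (BijGroup E)" if "g \<in> carrier G" for g
      using bij[OF that] by (simp add: BijGroup_def)
    show "\<phi> (g \<otimes> h) = \<phi> g \<otimes>\<^bsub>BijGroup E\<^esub> \<phi> h" if "g \<in> carrier G" "h \<in> carrier G" for g h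
    proof (rule extensionalityI[of _ E])
      show "\<phi> (g \<otimes> h) C = (\<phi> g \<otimes>\<^bsub>BijGroup E\<^esub> \<phi> h) C" if "C \<in> E" for C
        using that \<open>g \<in> carrier G\<close> \<open>h \<in> carrier G\<close> bij by (simp add: BijGroup_def mult compose_eq)
    qed (use that bij in \<open>simp_all add: BijGroup_def \<phi>_def\<close>)
  qed
  then have act: "group_action G E \<phi>"
    by (simp add: group_action_def group_hom_def group_hom_axioms_def group_BijGroup)
  show "transitive_action G E \<phi>"
  proof (intro transitive_action.intro act transitive_action_axioms.intro)
    fix C D assume "C \<in> E" "D \<in> E"
    then obtain h k where h: "h \<in> carrier G" "C = l_coset G h M" and k: "k \<in> carrier G" "D = l_coset G k M"
      by (auto simp: E_def)
    then have "\<phi> (k \<otimes> inv h) C = D" by (simp add: \<phi> m_assoc)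
    then show "\<exists>g\<in>carrier G. \<phi> g C = D" using h k by blast
  qed
  have M1: "M = l_coset G \<one> M" using sub by (simp add: lcos_mult_one)
  then show "M \<in> E" by (auto simp: E_def)
  have \<phi>M: "\<phi> g M = l_coset G g M" if "g \<in> carrier G" for g
    using \<phi>[OF that one_closed] that M1 by simp
  show "stabilizer G \<phi> M = M"
  proof
    show "stabilizer G \<phi> M \<subseteq> M"
    proof
      fix g assume "g \<in> stabilizer G \<phi> M"
      then have g: "g \<in> carrier G" "l_coset G g M = M" using \<phi>M by (auto simp: stabilizer_def)
      have "g \<otimes> \<one> \<in> l_coset G g M" using subgroup.one_closed[OF M] unfolding l_coset_def by blast
      then show "g \<in> M" using g by simp
    qed
    show "M \<subseteq> stabilizer G \<phi> M"
    proof
      fix g assume g: "g \<in> M"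
      then have gc: "g \<in> carrier G" using sub by blast
      have "l_coset G g M = M" using g M by (simp add: coset_join3 gc)
      then show "g \<in> stabilizer G \<phi> M" using gc \<phi>M by (simp add: stabilizer_def)
    qed
  qed
qed

text \<open>
  Every subgroup is a point stabiliser, namely of its own coset under left translation.
\<close>

theorem category_realisation_if_group_realisation:
  fixes G :: "'g monoid"
  assumes "group G" "group_countable_realisation TYPE('a) G"
  shows "category_countable_realisation TYPE('a) (Perm_Category G)"
  unfolding category_countable_realisation_def
proof (intro allI impI)
  fix A :: "'a monoid"
  assume "group A \<and> countable (carrier A)"
  then obtain M where M: "subgroup M G" and iso: "A \<cong> G\<lparr>carrier := normalizer G M\<rparr> Mod M"
    and A: "group A"
    using assms(2) unfolding group_countable_realisation_def by blast
  interpret group G by fact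
  define E where "E = {l_coset G g M |g. g \<in> carrier G}"
  define \<phi> where "\<phi> = (\<lambda>g. \<lambda>C\<in>E. l_coset G g C)"
  let ?S = "\<lparr>points = E, act = \<phi>\<rparr>"
  have act: "transitive_action G E \<phi>" and ME: "M \<in> E" and stab: "stabilizer G \<phi> M = M"
    using left_coset_action[OF M] unfolding E_def \<phi>_def by simp_all
  interpret transitive_action G E \<phi> by (rule act)
  have "automorphism_group (Perm_Category G) ?S \<cong> G\<lparr>carrier := normalizer G M\<rparr> Mod M"
    using automorphism_group_iso_normalizer_quotient[OF act ME] stab by simp
  then have "G\<lparr>carrier := normalizer G M\<rparr> Mod M \<cong> automorphism_group (Perm_Category G) ?S"
    by (rule group.iso_sym[OF group_automorphism_group[OF group_action_axioms]])
  with iso have "A \<cong> automorphism_group (Perm_Category G) ?S"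
    by (rule iso_trans)
  moreover have "?S \<in> objects (Perm_Category G)"
    by (simp add: objects_def group_action_axioms)
  moreover have "connected_object (Perm_Category G) ?S"
    using act ME by (auto simp: connected_object_def)
  ultimately show "\<exists>S :: ('g, 'g set) perm_rep. S \<in> objects (Perm_Category G) \<and>
      connected_object (Perm_Category G) S \<and> A \<cong> automorphism_group (Perm_Category G) S"
    by blast
qed

section \<open>Actions of presented groups with prescribed centraliser\<close>

text \<open>The prefix \<open>inv\<close> is the notation for inverses in a group, so functions get their own.\<close>

abbreviation inv_fun :: "('a \<Rightarrow> 'a) \<Rightarrow> 'a \<Rightarrow> 'a" where
  "inv_fun \<equiv> Hilbert_Choice.inv"

primrec eval_word :: "('x \<Rightarrow> 'b \<Rightarrow> 'b) \<Rightarrow> 'x word \<Rightarrow> 'b \<Rightarrow> 'b" where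
  "eval_word \<rho> [] = id"
| "eval_word \<rho> (l # w) = (if snd l then \<rho> (fst l) else inv_fun (\<rho> (fst l))) \<circ> eval_word \<rho> w"

lemma eval_word_append: "eval_word \<rho> (u @ v) = eval_word \<rho> u \<circ> eval_word \<rho> v"
  by (induction u) (auto simp: o_assoc)

lemma eval_word_power: "eval_word \<rho> (word_power w n) = eval_word \<rho> w ^^ n"
  by (induction n) (simp_all add: word_power_def eval_word_append)

text \<open>
  The bijections live on the whole type and preserve \<open>P\<close>, so that relators can be checked as
  equations between functions without restricting to \<open>P\<close>.
\<close>

locale presented_action =
  fixes rels :: "'x word set" and \<rho> :: "'x \<Rightarrow> 'b \<Rightarrow> 'b" and P :: "'b set"
  assumes bij: "bij (\<rho> i)" and image: "\<rho> i ` P = P"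
    and relators: "w \<in> rels \<Longrightarrow> eval_word \<rho> w = id"
begin

lemma inv_image: "inv_fun (\<rho> i) ` P = P"
  using image[of i] bij_is_inj[OF bij] by (metis image_inv_f_f)

lemma eval_bij: "bij (eval_word \<rho> w)"
proof (induction w)
  case (Cons l w)
  have "bij (if snd l then \<rho> (fst l) else inv_fun (\<rho> (fst l)))"
    using bij by (simp add: bij_imp_bij_inv)
  with Cons show ?case unfolding eval_word.simps by (rule bij_comp)
qed (simp only: eval_word.simps bij_id)

lemma eval_image: "eval_word \<rho> w ` P = P"
proof (induction w)
  case (Cons l w)
  have "(if snd l then \<rho> (fst l) else inv_fun (\<rho> (fst l))) ` P = P"
    by (simp add: image inv_image)
  with Cons show ?case unfolding eval_word.simps image_comp[symmetric] by simp
qed simp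

lemma eval_cong: "word_eq rels u v \<Longrightarrow> eval_word \<rho> u = eval_word \<rho> v"
proof (induction rule: word_eq.induct)
  case (cancel u i b v)
  have "\<rho> i \<circ> inv_fun (\<rho> i) = id" "inv_fun (\<rho> i) \<circ> \<rho> i = id"
    using bij[of i] by (simp_all add: bij_is_surj bij_is_inj flip: surj_iff inj_iff)
  then have "eval_word \<rho> [(i, b), (i, \<not> b)] = id" by simp
  then show ?case by (simp only: eval_word_append o_assoc o_id)
next
  case (relator r u v)
  then show ?case using relators by (simp add: eval_word_append)
qed simp_all

definition class_act :: "'x word set \<Rightarrow> 'b \<Rightarrow> 'b" where
  "class_act K = restrict (eval_word \<rho> (SOME w. w \<in> K)) P"

lemma class_act: "class_act (word_class rels w) = restrict (eval_word \<rho> w) P"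
proof -
  have "(SOME v. v \<in> word_class rels w) \<in> word_class rels w"
    by (rule someI[of _ w]) (simp add: word_class_def word_eq.refl)
  then show ?thesis using eval_cong by (auto simp: class_act_def word_class_def)
qed

lemma carrier_presented_group: "carrier (presented_group rels) = range (word_class rels)"
  by (simp add: presented_group_def)

lemma eval_closed: "\<omega> \<in> P \<Longrightarrow> eval_word \<rho> w \<omega> \<in> P"
  using eval_image[of w] by blast

lemma group_action_class_act: "group_action (presented_group rels) P class_act"
proof -
  have Bij: "restrict (eval_word \<rho> w) P \<in> Bij P" for w
    using eval_image[of w] bij_is_inj[OF eval_bij[of w]]
    by (auto simp: Bij_def bij_betw_def inj_on_def image_restrict_eq)
  have "class_act \<in> hom (presented_group rels) (BijGroup P)"
  proof (rule homI)
    show "class_act K \<in> carrier (BijGroup P)" if "K \<in> carrier (presented_group rels)" for K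
      using that Bij by (auto simp: carrier_presented_group class_act BijGroup_def)
    fix K L assume "K \<in> carrier (presented_group rels)" "L \<in> carrier (presented_group rels)"
    then obtain u v where "K = word_class rels u" "L = word_class rels v"
      by (auto simp: carrier_presented_group)
    then show "class_act (K \<otimes>\<^bsub>presented_group rels\<^esub> L) = class_act K \<otimes>\<^bsub>BijGroup P\<^esub> class_act L"
      using Bij eval_closed
      by (auto simp: mult_presented_group class_act BijGroup_def eval_word_append compose_def
          restrict_def fun_eq_iff)
  qed
  then show ?thesis
    by (simp add: group_action_def group_hom_def group_hom_axioms_def group_BijGroup
        group_presented_group)
qed

end

text \<open>
  What makes the centraliser of a transitive action equal to a given group \<open>A\<close>: a commuting action
  \<open>\<alpha>\<close> of \<open>A\<close>, free at a base point \<open>s\<close>, such that equivariant maps cannot take \<open>s\<close> out of its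
  \<open>A\<close>-orbit. Rigidity refers to all equivariant maps, as in practice \<open>s\<close> is recognised by equations
  (fixed points of words), and these survive under any such map.
\<close>

locale realising_action = presented_action rels \<rho> P + group A
  for rels :: "'x word set" and \<rho> :: "'x \<Rightarrow> 'b \<Rightarrow> 'b" and P :: "'b set"
    and A :: "('a, 'm) monoid_scheme" (structure) +
  fixes \<alpha> :: "'a \<Rightarrow> 'b \<Rightarrow> 'b" and s :: 'b
  assumes base: "s \<in> P"
    and connected: "s \<in> S \<Longrightarrow>
      (\<And>\<omega> i. \<omega> \<in> S \<Longrightarrow> \<rho> i \<omega> \<in> S \<and> inv_fun (\<rho> i) \<omega> \<in> S) \<Longrightarrow> P \<subseteq> S"
    and act_closed: "a \<in> carrier A \<Longrightarrow> \<omega> \<in> P \<Longrightarrow> \<alpha> a \<omega> \<in> P"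
    and act_mult: "a \<in> carrier A \<Longrightarrow> b \<in> carrier A \<Longrightarrow> \<omega> \<in> P \<Longrightarrow> \<alpha> (a \<otimes> b) \<omega> = \<alpha> a (\<alpha> b \<omega>)"
    and act_one: "\<omega> \<in> P \<Longrightarrow> \<alpha> \<one> \<omega> = \<omega>"
    and act_commute: "a \<in> carrier A \<Longrightarrow> \<omega> \<in> P \<Longrightarrow> \<alpha> a (\<rho> i \<omega>) = \<rho> i (\<alpha> a \<omega>)"
    and act_free: "a \<in> carrier A \<Longrightarrow> \<alpha> a s = s \<Longrightarrow> a = \<one>"
    and rigid: "h \<in> P \<rightarrow> P \<Longrightarrow> (\<And>\<omega> i. \<omega> \<in> P \<Longrightarrow> h (\<rho> i \<omega>) = \<rho> i (h \<omega>)) \<Longrightarrow>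
      \<exists>a\<in>carrier A. h s = \<alpha> a s"
begin

lemma reachable:
  assumes "\<omega> \<in> P"
  obtains w where "\<omega> = eval_word \<rho> w s"
proof -
  have "P \<subseteq> range (\<lambda>w. eval_word \<rho> w s)"
  proof (rule connected)
    have "s = eval_word \<rho> [] s" by simp
    then show "s \<in> range (\<lambda>w. eval_word \<rho> w s)" by (rule range_eqI)
    fix \<omega> i assume "\<omega> \<in> range (\<lambda>w. eval_word \<rho> w s)"
    then obtain w where w: "\<omega> = eval_word \<rho> w s" by blast
    have "\<rho> i \<omega> = eval_word \<rho> ((i, True) # w) s" "inv_fun (\<rho> i) \<omega> = eval_word \<rho> ((i, False) # w) s"
      by (simp_all add: w)
    then show "\<rho> i \<omega> \<in> range (\<lambda>w. eval_word \<rho> w s) \<and> inv_fun (\<rho> i) \<omega> \<in> range (\<lambda>w. eval_word \<rho> w s)"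
      by blast
  qed
  then show ?thesis using assms that by blast
qed

lemma transitive: "transitive_action (presented_group rels) P class_act"
proof (intro transitive_action.intro group_action_class_act transitive_action_axioms.intro)
  fix \<omega> \<omega>' assume \<omega>: "\<omega> \<in> P" and \<omega>': "\<omega>' \<in> P"
  obtain u where u: "\<omega> = eval_word \<rho> u s" using reachable[OF \<omega>] .
  obtain v where v: "\<omega>' = eval_word \<rho> v s" using reachable[OF \<omega>'] .
  have "eval_word \<rho> (inv_word u @ u) = id"
    using eval_cong[OF word_eq_inv_word[of rels u]] by simp
  then have "eval_word \<rho> (inv_word u) (eval_word \<rho> u s) = s"
    by (metis eval_word_append comp_apply id_apply)
  then have "eval_word \<rho> (v @ inv_word u) \<omega> = \<omega>'"
    by (simp add: eval_word_append u v)
  then have "class_act (word_class rels (v @ inv_word u)) \<omega> = \<omega>'"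
    using \<omega> by (simp add: class_act)
  then show "\<exists>g\<in>carrier (presented_group rels). class_act g \<omega> = \<omega>'"
    by (auto simp: carrier_presented_group)
qed

lemma commute_eval:
  assumes h: "h \<in> P \<rightarrow> P" and comm: "\<And>\<omega> i. \<omega> \<in> P \<Longrightarrow> h (\<rho> i \<omega>) = \<rho> i (h \<omega>)" and \<omega>: "\<omega> \<in> P"
  shows "h (eval_word \<rho> w \<omega>) = eval_word \<rho> w (h \<omega>)"
proof (induction w)
  case (Cons l w)
  let ?\<nu> = "eval_word \<rho> w \<omega>"
  have \<nu>: "?\<nu> \<in> P" using eval_closed[OF \<omega>] .
  have "h (inv_fun (\<rho> i) ?\<nu>) = inv_fun (\<rho> i) (h ?\<nu>)" for i
  proof -
    have "inv_fun (\<rho> i) ?\<nu> \<in> P" using inv_image \<nu> by blast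
    from comm[OF this, of i] have "h ?\<nu> = \<rho> i (h (inv_fun (\<rho> i) ?\<nu>))"
      using bij[of i] by (simp add: bij_is_surj surj_f_inv_f)
    then show ?thesis using bij[of i] by (simp add: bij_is_inj inv_f_f)
  qed
  then show ?case using Cons comm[OF \<nu>] by simp
qed simp

text \<open>
  By transitivity two equivariant maps that agree at \<open>s\<close> are equal. Hence rigidity says that each
  automorphism is the action of some element of \<open>A\<close>, and freeness that this element is unique.
\<close>

theorem automorphism_group_iso:
  "A \<cong> automorphism_group (Perm_Category (presented_group rels)) \<lparr>points = P, act = class_act\<rparr>"
    (is "A \<cong> ?Aut")
proof -
  have Aut: "f \<in> carrier ?Aut \<longleftrightarrow> f \<in> extensional P \<and> bij_betw f P P \<and>
      (\<forall>w. \<forall>\<omega>\<in>P. f (eval_word \<rho> w \<omega>) = eval_word \<rho> w (f \<omega>))" for f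
    by (auto simp: automorphism_group_carrier Bij_def equivariant_maps_def PiE_def
        carrier_presented_group class_act dest: bij_betwE)
  define \<Phi> where "\<Phi> a = restrict (\<alpha> a) P" for a
  have \<Phi>_in: "\<Phi> a \<in> carrier ?Aut" if a: "a \<in> carrier A" for a
  proof -
    have "bij_betw (\<Phi> a) P P"
      by (rule bij_betw_byWitness[of _ "\<alpha> (inv a)"])
        (use a act_closed in \<open>auto simp: \<Phi>_def act_one simp flip: act_mult\<close>)
    moreover have "\<alpha> a \<in> P \<rightarrow> P" using act_closed[OF a] by blast
    ultimately show ?thesis
      unfolding Aut using commute_eval[of "\<alpha> a"] act_commute[OF a] eval_closed by (simp add: \<Phi>_def)
  qed
  have "\<Phi> \<in> iso A ?Aut"
  proof (rule isoI)
    show "\<Phi> \<in> hom A ?Aut"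
    proof (rule homI)
      fix a b assume ab: "a \<in> carrier A" "b \<in> carrier A"
      show "\<Phi> (a \<otimes> b) = \<Phi> a \<otimes>\<^bsub>?Aut\<^esub> \<Phi> b"
        unfolding automorphism_group_mult[OF \<Phi>_in[OF ab(1)] \<Phi>_in[OF ab(2)]]
        using ab act_closed by (auto simp: \<Phi>_def act_mult compose_def restrict_def fun_eq_iff)
    qed (rule \<Phi>_in)
    have "a = b" if ab: "a \<in> carrier A" "b \<in> carrier A" and eq: "\<Phi> a = \<Phi> b" for a b
    proof -
      have "\<alpha> a s = \<alpha> b s" using eq base by (simp add: \<Phi>_def restrict_def fun_eq_iff) metis
      then have "\<alpha> (inv b \<otimes> a) s = s" using ab base act_mult act_one by (metis inv_closed l_inv)
      then have "inv b \<otimes> a = \<one>" using ab act_free by simp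
      then show ?thesis using ab by (metis inv_closed inv_equality inv_inv)
    qed
    moreover have "f \<in> \<Phi> ` carrier A" if f: "f \<in> carrier ?Aut" for f
    proof -
      have fP: "f \<in> P \<rightarrow> P" and fext: "f \<in> extensional P"
        and fw: "\<And>w \<omega>. \<omega> \<in> P \<Longrightarrow> f (eval_word \<rho> w \<omega>) = eval_word \<rho> w (f \<omega>)"
        using f unfolding Aut by (auto dest: bij_betwE)
      have "f (\<rho> i \<omega>) = \<rho> i (f \<omega>)" if "\<omega> \<in> P" for i \<omega>
        using fw[OF that, of "[(i, True)]"] by simp
      then obtain a where a: "a \<in> carrier A" "f s = \<alpha> a s" using rigid[OF fP] by blast
      have aw: "\<alpha> a (eval_word \<rho> w s) = eval_word \<rho> w (\<alpha> a s)" for w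
        by (rule commute_eval) (use a act_closed act_commute base in auto)
      have "f = \<Phi> a"
      proof (rule extensionalityI[OF fext])
        fix \<omega> assume \<omega>: "\<omega> \<in> P"
        then obtain w where "\<omega> = eval_word \<rho> w s" by (rule reachable)
        then show "f \<omega> = \<Phi> a \<omega>" using fw[OF base] aw a \<omega> by (simp add: \<Phi>_def)
      qed (simp add: \<Phi>_def)
      then show ?thesis using a by blast
    qed
    ultimately show "bij_betw \<Phi> (carrier A) (carrier ?Aut)"
      using \<Phi>_in by (auto simp: bij_betw_def inj_on_def)
  qed
  then show ?thesis by (auto simp: is_iso_def)
qed

corollary realised:
  "\<exists>M. subgroup M (presented_group rels) \<and>
    A \<cong> presented_group rels\<lparr>carrier := normalizer (presented_group rels) M\<rparr> Mod M"
  using iso_trans[OF automorphism_group_iso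
      automorphism_group_iso_normalizer_quotient[OF transitive base]]
    group_action.stabilizer_subgroup[OF group_action_class_act base] by blast

end

section \<open>Rigid and chiral representations of triangle groups\<close>

lemma commute_inv:
  assumes h: "h \<in> P \<rightarrow> P" and comm: "\<And>\<omega>. \<omega> \<in> P \<Longrightarrow> h (F \<omega>) = F (h \<omega>)"
    and F: "F permutes P" and \<omega>: "\<omega> \<in> P"
  shows "h (inv_fun F \<omega>) = inv_fun F (h \<omega>)"
proof -
  have "inv_fun F \<omega> \<in> P" using permutes_inv[OF F] \<omega> by (simp add: permutes_in_image)
  then have "h \<omega> = F (h (inv_fun F \<omega>))" using comm[of "inv_fun F \<omega>"] permutes_inverses(1)[OF F] by simp
  then show ?thesis using permutes_inverses(2)[OF F] by simp
qed

text \<open>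
  A permutation representation of \<open>\<Delta>(p,q,r)\<close> that realises \<open>A\<close> in the sense above. Rigidity is
  enough for the triangle group. Chirality, needed for the extended group, says that there is no equivariant
  map to the mirror image, in which \<open>x\<close> and \<open>y\<close> are replaced by their inverses. The set \<open>S\<close> in
  connectedness is closed under inverses as well as generators, so that the condition does not change
  when the generators are replaced by their inverses.
\<close>

locale triangle_system = group A for A :: "('a, 'm) monoid_scheme" (structure) +
  fixes p q r :: nat and P :: "'b set" and x y z :: "'b \<Rightarrow> 'b" and \<alpha> :: "'a \<Rightarrow> 'b \<Rightarrow> 'b" and s :: 'b
  assumes perm: "x permutes P" "y permutes P" "z permutes P"
    and order: "x ^^ p = id" "y ^^ q = id" "z ^^ r = id"
    and XYZ: "x \<circ> y \<circ> z = id"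
    and base: "s \<in> P"
    and connected: "s \<in> S \<Longrightarrow>
      (\<And>\<omega>. \<omega> \<in> S \<Longrightarrow> {x \<omega>, y \<omega>, z \<omega>, inv_fun x \<omega>, inv_fun y \<omega>, inv_fun z \<omega>} \<subseteq> S) \<Longrightarrow> P \<subseteq> S"
    and act_closed: "a \<in> carrier A \<Longrightarrow> \<omega> \<in> P \<Longrightarrow> \<alpha> a \<omega> \<in> P"
    and act_mult: "a \<in> carrier A \<Longrightarrow> b \<in> carrier A \<Longrightarrow> \<omega> \<in> P \<Longrightarrow> \<alpha> (a \<otimes> b) \<omega> = \<alpha> a (\<alpha> b \<omega>)"
    and act_one: "\<omega> \<in> P \<Longrightarrow> \<alpha> \<one> \<omega> = \<omega>"
    and act_commute: "a \<in> carrier A \<Longrightarrow> \<omega> \<in> P \<Longrightarrow>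
      \<alpha> a (x \<omega>) = x (\<alpha> a \<omega>) \<and> \<alpha> a (y \<omega>) = y (\<alpha> a \<omega>) \<and> \<alpha> a (z \<omega>) = z (\<alpha> a \<omega>)"
    and act_free: "a \<in> carrier A \<Longrightarrow> \<alpha> a s = s \<Longrightarrow> a = \<one>"
    and rigid: "h \<in> P \<rightarrow> P \<Longrightarrow>
      (\<And>\<omega>. \<omega> \<in> P \<Longrightarrow> h (x \<omega>) = x (h \<omega>) \<and> h (y \<omega>) = y (h \<omega>) \<and> h (z \<omega>) = z (h \<omega>)) \<Longrightarrow>
      \<exists>a\<in>carrier A. h s = \<alpha> a s"
    and chiral: "h \<in> P \<rightarrow> P \<Longrightarrow>
      (\<And>\<omega>. \<omega> \<in> P \<Longrightarrow> x (h (x \<omega>)) = h \<omega> \<and> y (h (y \<omega>)) = h \<omega>) \<Longrightarrow> False"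
begin

lemmas perm_inv = perm[THEN permutes_inv]
lemmas perm_closed = perm[THEN permutes_in_image, THEN iffD2]
  and perm_inv_closed = perm_inv[THEN permutes_in_image, THEN iffD2]
lemmas inverses [simp] = perm[THEN permutes_inverses(1)] perm[THEN permutes_inverses(2)]

lemma XYZ_at: "x (y (z \<omega>)) = \<omega>"
  using XYZ by (metis comp_apply id_apply)

lemma YZX_at: "y (z (x \<omega>)) = \<omega>"
  using XYZ_at[of "x \<omega>"] by (metis inverses(4))

lemma ZXY_at: "z (x (y \<omega>)) = \<omega>"
  using YZX_at[of "y \<omega>"] by (metis inverses(5))

text \<open>
  The three generators play symmetric roles up to conjugation: a map reversing \<open>y\<close> and \<open>z\<close> becomes
  one reversing \<open>x\<close> and \<open>y\<close> when composed with \<open>y\<close>. With the next lemma this allows the three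
  periods to be permuted arbitrarily.
\<close>

lemma rotate: "triangle_system A q r p P y z x \<alpha> s"
proof unfold_locales
  show "y \<circ> z \<circ> x = id" by (auto simp: YZX_at)
  show "P \<subseteq> S" if "s \<in> S"
    "\<And>\<omega>. \<omega> \<in> S \<Longrightarrow> {y \<omega>, z \<omega>, x \<omega>, inv_fun y \<omega>, inv_fun z \<omega>, inv_fun x \<omega>} \<subseteq> S" for S
    by (rule connected) (use that in auto)
  show "\<exists>a\<in>carrier A. h s = \<alpha> a s" if "h \<in> P \<rightarrow> P"
    "\<And>\<omega>. \<omega> \<in> P \<Longrightarrow> h (y \<omega>) = y (h \<omega>) \<and> h (z \<omega>) = z (h \<omega>) \<and> h (x \<omega>) = x (h \<omega>)" for h
    by (rule rigid) (use that in auto)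
  show False if h: "h \<in> P \<rightarrow> P"
    and rev: "\<And>\<omega>. \<omega> \<in> P \<Longrightarrow> y (h (y \<omega>)) = h \<omega> \<and> z (h (z \<omega>)) = h \<omega>" for h
  proof (rule chiral[of "y \<circ> h"])
    show "y \<circ> h \<in> P \<rightarrow> P" using h perm_closed(2) by (simp add: Pi_iff)
    fix \<omega> assume \<omega>: "\<omega> \<in> P"
    have "x \<omega> \<in> P" "z (x \<omega>) \<in> P" using \<omega> perm_closed by auto
    then have "y (h \<omega>) = h (z (x \<omega>))" "z (h (z (x \<omega>))) = h (x \<omega>)"
      using rev YZX_at by metis+
    then have "x (y (h (x \<omega>))) = y (h \<omega>)" using XYZ_at by metis
    then show "x ((y \<circ> h) (x \<omega>)) = (y \<circ> h) \<omega> \<and> y ((y \<circ> h) (y \<omega>)) = (y \<circ> h) \<omega>"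
      using rev[OF \<omega>] by simp
  qed
qed (use perm order base act_closed act_mult act_one act_commute act_free in auto)

lemma reflect: "triangle_system A q p r P (inv_fun y) (inv_fun x) (inv_fun z) \<alpha> s"
proof unfold_locales
  have inv_inv: "inv_fun (inv_fun x) = x" "inv_fun (inv_fun y) = y" "inv_fun (inv_fun z) = z"
    using perm by (simp_all add: inv_inv_eq permutes_bij)
  show "inv_fun y permutes P" "inv_fun x permutes P" "inv_fun z permutes P" by (rule perm_inv)+
  show "inv_fun y ^^ q = id" "inv_fun x ^^ p = id" "inv_fun z ^^ r = id"
    using perm order by (simp_all flip: inv_fn add: permutes_bij)
  show "inv_fun y \<circ> inv_fun x \<circ> inv_fun z = id"
  proof
    fix \<omega>
    show "(inv_fun y \<circ> inv_fun x \<circ> inv_fun z) \<omega> = id \<omega>"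
      using ZXY_at[of "inv_fun y (inv_fun x (inv_fun z \<omega>))"] by simp
  qed
  show "s \<in> P" by (rule base)
  show "P \<subseteq> S" if "s \<in> S"
    "\<And>\<omega>. \<omega> \<in> S \<Longrightarrow> {inv_fun y \<omega>, inv_fun x \<omega>, inv_fun z \<omega>, inv_fun (inv_fun y) \<omega>, inv_fun (inv_fun x) \<omega>, inv_fun (inv_fun z) \<omega>} \<subseteq> S" for S
    by (rule connected) (use that in \<open>auto simp: inv_inv\<close>)
  show "\<alpha> a (inv_fun y \<omega>) = inv_fun y (\<alpha> a \<omega>) \<and> \<alpha> a (inv_fun x \<omega>) = inv_fun x (\<alpha> a \<omega>) \<and>
      \<alpha> a (inv_fun z \<omega>) = inv_fun z (\<alpha> a \<omega>)" if "a \<in> carrier A" "\<omega> \<in> P" for a \<omega>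
    using that act_closed act_commute perm by (auto intro!: commute_inv[of _ P])
  show "\<exists>a\<in>carrier A. h s = \<alpha> a s" if h: "h \<in> P \<rightarrow> P"
    and comm: "\<And>\<omega>. \<omega> \<in> P \<Longrightarrow> h (inv_fun y \<omega>) = inv_fun y (h \<omega>) \<and> h (inv_fun x \<omega>) = inv_fun x (h \<omega>) \<and>
      h (inv_fun z \<omega>) = inv_fun z (h \<omega>)" for h
  proof (rule rigid[OF h])
    fix \<omega> assume "\<omega> \<in> P"
    then show "h (x \<omega>) = x (h \<omega>) \<and> h (y \<omega>) = y (h \<omega>) \<and> h (z \<omega>) = z (h \<omega>)"
      using commute_inv[OF h _ perm_inv(1)] commute_inv[OF h _ perm_inv(2)]
        commute_inv[OF h _ perm_inv(3)] comm by (auto simp: inv_inv)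
  qed
  show False if h: "h \<in> P \<rightarrow> P"
    and rev: "\<And>\<omega>. \<omega> \<in> P \<Longrightarrow> inv_fun y (h (inv_fun y \<omega>)) = h \<omega> \<and> inv_fun x (h (inv_fun x \<omega>)) = h \<omega>" for h
  proof (rule chiral[OF h])
    fix \<omega> assume \<omega>: "\<omega> \<in> P"
    then have "inv_fun x (h \<omega>) = h (x \<omega>)" "inv_fun y (h \<omega>) = h (y \<omega>)"
      using rev perm_closed by (metis inverses(4), metis inverses(5))
    then show "x (h (x \<omega>)) = h \<omega> \<and> y (h (y \<omega>)) = h \<omega>" by (metis inverses(1,2))
  qed
qed (use act_closed act_mult act_one act_free in auto)

lemma multiples:
  assumes "p dvd p'" "q dvd q'" "r dvd r'"
  shows "triangle_system A p' q' r' P x y z \<alpha> s"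
proof -
  have pow: "F ^^ m = id \<Longrightarrow> m dvd m' \<Longrightarrow> F ^^ m' = id" for F :: "'b \<Rightarrow> 'b" and m m'
    by (auto simp: dvd_def funpow_mult simp flip: funpow_mult)
  show ?thesis
  proof unfold_locales
    show "x ^^ p' = id" "y ^^ q' = id" "z ^^ r' = id"
      using order assms pow by blast+
  qed (fact perm XYZ base connected act_closed act_mult act_one act_commute act_free rigid chiral)+
qed

end

context triangle_system
begin

primrec rotate_by :: "rotation \<Rightarrow> 'b \<Rightarrow> 'b" where
  "rotate_by RotX = x" | "rotate_by RotY = y" | "rotate_by RotZ = z"

theorem triangle_group_realises:
  "\<exists>M. subgroup M (triangle_group p q r) \<and>
    A \<cong> triangle_group p q r\<lparr>carrier := normalizer (triangle_group p q r) M\<rparr> Mod M"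
  unfolding triangle_group_def
proof (rule realising_action.realised, unfold_locales)
  show "bij (rotate_by i)" "rotate_by i ` P = P" for i
    using perm by (cases i; simp add: permutes_bij permutes_image)+
  show "eval_word rotate_by w = id"
    if "w \<in> {word_power (gen RotX) p, word_power (gen RotY) q, word_power (gen RotZ) r,
      gen RotX @ gen RotY @ gen RotZ}" for w
    using that order XYZ by (auto simp: eval_word_power o_assoc)
  show "s \<in> P" by (rule base)
  show "P \<subseteq> S" if "s \<in> S"
    "\<And>\<omega> i. \<omega> \<in> S \<Longrightarrow> rotate_by i \<omega> \<in> S \<and> inv_fun (rotate_by i) \<omega> \<in> S" for S
    by (rule connected[OF that(1)])
      (use that(2)[of _ RotX] that(2)[of _ RotY] that(2)[of _ RotZ] in auto)
  show "\<alpha> a (rotate_by i \<omega>) = rotate_by i (\<alpha> a \<omega>)" if "a \<in> carrier A" "\<omega> \<in> P" for a i \<omega>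
    using act_commute[OF that] by (cases i) auto
  show "\<exists>a\<in>carrier A. h s = \<alpha> a s" if h: "h \<in> P \<rightarrow> P" and
    comm: "\<And>\<omega> i. \<omega> \<in> P \<Longrightarrow> h (rotate_by i \<omega>) = rotate_by i (h \<omega>)" for h
    by (rule rigid[OF h])
      (use comm[of _ RotX] comm[of _ RotY] comm[of _ RotZ] in auto)
qed (use act_closed act_mult act_one act_free in auto)

text \<open>
  The extended group acts on two copies of \<open>P\<close>, the second being the mirror image of the first: there
  \<open>x\<close> and \<open>y\<close> act as their inverses. \<open>R\<^sub>2\<close> exchanges the copies identically, and the other two
  reflections are forced by \<open>R\<^sub>1R\<^sub>2 = x\<close> and \<open>R\<^sub>2R\<^sub>0 = y\<close> on the first copy.
\<close>

primrec reflect_by :: "reflection \<Rightarrow> 'b \<times> bool \<Rightarrow> 'b \<times> bool" where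
  "reflect_by Refl0 = (\<lambda>(\<omega>, b). (if b then y \<omega> else inv_fun y \<omega>, \<not> b))"
| "reflect_by Refl1 = (\<lambda>(\<omega>, b). (if b then inv_fun x \<omega> else x \<omega>, \<not> b))"
| "reflect_by Refl2 = (\<lambda>(\<omega>, b). (\<omega>, \<not> b))"

lemma reflect_by_involution: "reflect_by i (reflect_by i v) = v"
  by (cases i; cases v) simp_all

lemma reflect_by_inv: "inv_fun (reflect_by i) = reflect_by i"
  by (rule inv_unique_comp) (auto simp: fun_eq_iff reflect_by_involution)

lemma reflect_by_snd: "snd (reflect_by i v) = (\<not> snd v)"
  by (cases i; cases v) simp_all

lemma z_eq: "z \<omega> = inv_fun y (inv_fun x \<omega>)" and z_inv_eq: "inv_fun z \<omega> = x (y \<omega>)"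
proof -
  show "z \<omega> = inv_fun y (inv_fun x \<omega>)" using XYZ_at[of \<omega>] by (metis inverses(4,5))
  show "inv_fun z \<omega> = x (y \<omega>)" using ZXY_at[of \<omega>] by (metis inverses(6))
qed

lemma reflect_by_pairs:
  "reflect_by Refl1 (reflect_by Refl2 (\<omega>, b)) = (if b then x \<omega> else inv_fun x \<omega>, b)"
  "reflect_by Refl2 (reflect_by Refl0 (\<omega>, b)) = (if b then y \<omega> else inv_fun y \<omega>, b)"
  "reflect_by Refl0 (reflect_by Refl1 (\<omega>, b)) = (if b then z \<omega> else y (x \<omega>), b)"
  "reflect_by Refl2 (reflect_by Refl1 (\<omega>, b)) = (if b then inv_fun x \<omega> else x \<omega>, b)"
  "reflect_by Refl0 (reflect_by Refl2 (\<omega>, b)) = (if b then inv_fun y \<omega> else y \<omega>, b)"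
  "reflect_by Refl1 (reflect_by Refl0 (\<omega>, True)) = (inv_fun z \<omega>, True)"
  by (simp_all add: z_eq z_inv_eq)

lemma funpow_two_sheets:
  fixes f g :: "'b \<Rightarrow> 'b"
  shows
  "((\<lambda>(\<omega>, b). (if b then f \<omega> else g \<omega>, b)) ^^ k) = (\<lambda>(\<omega>, b). (if b then (f ^^ k) \<omega> else (g ^^ k) \<omega>, b))"
  by (induction k) (auto simp: fun_eq_iff)

text \<open>On the mirror copy \<open>R\<^sub>0R\<^sub>1\<close> acts as \<open>yx\<close>, a conjugate of \<open>xy = z\<inverse>\<close>.\<close>

lemma yx_order: "(y \<circ> x) ^^ r = id"
proof
  fix \<omega>
  have "x (((y \<circ> x) ^^ k) \<omega>) = (inv_fun z ^^ k) (x \<omega>)" for k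
    by (induction k) (simp_all add: z_inv_eq)
  moreover have "inv_fun z ^^ r = id"
    using perm order by (simp flip: inv_fn add: permutes_bij)
  ultimately have "x (((y \<circ> x) ^^ r) \<omega>) = x \<omega>" by simp
  then show "((y \<circ> x) ^^ r) \<omega> = id \<omega>" by (metis inverses(4) id_apply)
qed

text \<open>
  The rotations preserve each of the two copies, so by connectedness an equivariant map either
  preserves or exchanges them. In the first case it restricts to an equivariant map of the triangle
  group, to which rigidity applies; an exchange would be a map onto the mirror image, which chirality
  excludes.
\<close>

theorem extended_triangle_group_realises:
  "\<exists>M. subgroup M (extended_triangle_group p q r) \<and>
    A \<cong> extended_triangle_group p q r\<lparr>carrier := normalizer (extended_triangle_group p q r) M\<rparr> Mod M"
  unfolding extended_triangle_group_def
proof (rule realising_action.realised, unfold_locales)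
  let ?P = "P \<times> (UNIV :: bool set)"
  let ?\<alpha> = "\<lambda>a (\<omega>, b :: bool). (\<alpha> a \<omega>, b)"
  have closed: "reflect_by i v \<in> ?P" if "v \<in> ?P" for i v
    using that perm_closed perm_inv_closed by (cases i; cases v) auto
  show "bij (reflect_by i)" for i
    by (rule o_bij[of "reflect_by i"]) (auto simp: fun_eq_iff reflect_by_involution)
  show "reflect_by i ` ?P = ?P" for i
  proof
    show "reflect_by i ` ?P \<subseteq> ?P" using closed by blast
    show "?P \<subseteq> reflect_by i ` ?P"
    proof
      fix v assume "v \<in> ?P"
      then have "reflect_by i v \<in> ?P" by (rule closed)
      then show "v \<in> reflect_by i ` ?P" by (metis reflect_by_involution image_eqI)
    qed
  qed
  show "eval_word reflect_by w = id"
    if "w \<in> {word_power (gen Refl0) 2, word_power (gen Refl1) 2, word_power (gen Refl2) 2,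
      word_power (gen Refl1 @ gen Refl2) p, word_power (gen Refl2 @ gen Refl0) q,
      word_power (gen Refl0 @ gen Refl1) r}" for w
  proof -
    have two: "eval_word reflect_by (word_power (gen i) 2) = id" for i
      by (simp add: eval_word_power numeral_2_eq_2 fun_eq_iff reflect_by_involution
          del: reflect_by.simps)
    have rot: "eval_word reflect_by (word_power (gen i @ gen j) k) = id"
      if "\<And>\<omega> b. reflect_by i (reflect_by j (\<omega>, b)) = (if b then f \<omega> else g \<omega>, b)"
        "f ^^ k = id" "g ^^ k = id" for i j k f g
    proof -
      have "reflect_by i \<circ> reflect_by j = (\<lambda>(\<omega>, b). (if b then f \<omega> else g \<omega>, b))"
        using that(1) by (auto simp: fun_eq_iff)
      then show ?thesis
        using that(2,3) by (simp add: eval_word_power funpow_two_sheets) (auto simp: fun_eq_iff)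
    qed
    have inv_order: "inv_fun x ^^ p = id" "inv_fun y ^^ q = id"
      using perm order by (simp_all flip: inv_fn add: permutes_bij)
    have "eval_word reflect_by (word_power (gen Refl1 @ gen Refl2) p) = id"
      by (rule rot[OF reflect_by_pairs(1)]) (simp_all add: order inv_order)
    moreover have "eval_word reflect_by (word_power (gen Refl2 @ gen Refl0) q) = id"
      by (rule rot[OF reflect_by_pairs(2)]) (simp_all add: order inv_order)
    moreover have "eval_word reflect_by (word_power (gen Refl0 @ gen Refl1) r) = id"
      by (rule rot[of _ _ z "y \<circ> x"]) (simp_all only: reflect_by_pairs(3) o_apply order yx_order)
    ultimately show ?thesis using that two by blast
  qed
  show "(s, True) \<in> ?P" using base by simp
  show "?P \<subseteq> S" if s: "(s, True) \<in> S" and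
    cl: "\<And>v i. v \<in> S \<Longrightarrow> reflect_by i v \<in> S \<and> inv_fun (reflect_by i) v \<in> S" for S
  proof -
    have step: "reflect_by i v \<in> S" if "v \<in> S" for i v using cl[OF that] by blast
    have "P \<subseteq> {\<omega>. (\<omega>, True) \<in> S}"
    proof (rule connected)
      fix \<omega> assume "\<omega> \<in> {\<omega>. (\<omega>, True) \<in> S}"
      then have two: "reflect_by i (reflect_by j (\<omega>, True)) \<in> S" for i j using step by blast
      show "{x \<omega>, y \<omega>, z \<omega>, inv_fun x \<omega>, inv_fun y \<omega>, inv_fun z \<omega>} \<subseteq> {\<omega>. (\<omega>, True) \<in> S}"
        using two[of Refl1 Refl2] two[of Refl2 Refl0] two[of Refl0 Refl1] two[of Refl2 Refl1]
          two[of Refl0 Refl2] two[of Refl1 Refl0]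
        by (simp add: reflect_by_pairs del: reflect_by.simps)
    qed (use s in simp)
    then have pos: "(\<omega>, True) \<in> S" if "\<omega> \<in> P" for \<omega> using that by blast
    have "(\<omega>, b) \<in> S" if "\<omega> \<in> P" for \<omega> b
      using pos[OF that] step[OF pos[OF that], of Refl2] by (cases b) auto
    then show ?thesis by auto
  qed
  show "\<exists>a\<in>carrier A. h (s, True) = ?\<alpha> a (s, True)" if h: "h \<in> ?P \<rightarrow> ?P" and
    comm: "\<And>v i. v \<in> ?P \<Longrightarrow> h (reflect_by i v) = reflect_by i (h v)" for h
  proof -
    define k where "k \<omega> = fst (h (\<omega>, True))" for \<omega>
    define \<beta> where "\<beta> = snd (h (s, True))"
    have two: "h (reflect_by i (reflect_by j (\<omega>, True))) = reflect_by i (reflect_by j (h (\<omega>, True)))"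
      if "\<omega> \<in> P" for i j \<omega>
      using that comm closed by (simp del: reflect_by.simps)
    have sheet: "snd (h (\<omega>, True)) = \<beta>" if "\<omega> \<in> P" for \<omega>
    proof -
      let ?S = "{\<omega> \<in> P. snd (h (\<omega>, True)) = \<beta>}"
      have "P \<subseteq> ?S"
      proof (rule connected)
        fix \<omega> assume \<omega>: "\<omega> \<in> ?S"
        have "snd (h (reflect_by i (reflect_by j (\<omega>, True)))) = \<beta>" for i j
          using two[of \<omega> i j] \<omega> by (simp add: reflect_by_snd del: reflect_by.simps)
        note this[of Refl1 Refl2] this[of Refl2 Refl0] this[of Refl0 Refl1] this[of Refl2 Refl1]
          this[of Refl0 Refl2] this[of Refl1 Refl0]
        then show "{x \<omega>, y \<omega>, z \<omega>, inv_fun x \<omega>, inv_fun y \<omega>, inv_fun z \<omega>} \<subseteq> ?S"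
          using \<omega> perm_closed perm_inv_closed
          by (simp add: reflect_by_pairs del: reflect_by.simps)
      qed (use base in \<open>simp add: \<beta>_def\<close>)
      then show ?thesis using that by blast
    qed
    have hk: "h (\<omega>, True) = (k \<omega>, \<beta>)" if "\<omega> \<in> P" for \<omega>
      using sheet[OF that] by (simp add: k_def prod_eq_iff)
    have kP: "k \<in> P \<rightarrow> P"
    proof
      fix \<omega> assume \<omega>: "\<omega> \<in> P"
      then have "h (\<omega>, True) \<in> ?P" using h by blast
      then show "k \<omega> \<in> P" by (simp add: hk[OF \<omega>])
    qed
    have images: "(k (x \<omega>), \<beta>) = reflect_by Refl1 (reflect_by Refl2 (k \<omega>, \<beta>))"
      "(k (y \<omega>), \<beta>) = reflect_by Refl2 (reflect_by Refl0 (k \<omega>, \<beta>))"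
      "(k (z \<omega>), \<beta>) = reflect_by Refl0 (reflect_by Refl1 (k \<omega>, \<beta>))" if "\<omega> \<in> P" for \<omega>
      using two[OF that, of Refl1 Refl2] two[OF that, of Refl2 Refl0] two[OF that, of Refl0 Refl1]
        hk that perm_closed by (simp_all add: reflect_by_pairs del: reflect_by.simps)
    have \<beta>
    proof (rule ccontr)
      assume "\<not> \<beta>"
      then have "k (x \<omega>) = inv_fun x (k \<omega>) \<and> k (y \<omega>) = inv_fun y (k \<omega>)" if "\<omega> \<in> P" for \<omega>
        using images[OF that] by (simp add: reflect_by_pairs del: reflect_by.simps)
      then show False using chiral[OF kP] by simp
    qed
    then have "k (x \<omega>) = x (k \<omega>) \<and> k (y \<omega>) = y (k \<omega>) \<and> k (z \<omega>) = z (k \<omega>)" if "\<omega> \<in> P" for \<omega>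
      using images[OF that] by (simp add: reflect_by_pairs del: reflect_by.simps)
    then obtain a where "a \<in> carrier A" "k s = \<alpha> a s" using rigid[OF kP] by blast
    then show ?thesis using hk[OF base] \<open>\<beta>\<close> by auto
  qed
  show "?\<alpha> a (reflect_by i v) = reflect_by i (?\<alpha> a v)" if a: "a \<in> carrier A" and v: "v \<in> ?P" for a i v
  proof -
    obtain \<omega> b where \<omega>: "v = (\<omega>, b)" "\<omega> \<in> P" using v by auto
    have \<alpha>: "\<alpha> a \<in> P \<rightarrow> P" using act_closed[OF a] by blast
    have "\<alpha> a (inv_fun x \<omega>) = inv_fun x (\<alpha> a \<omega>)" "\<alpha> a (inv_fun y \<omega>) = inv_fun y (\<alpha> a \<omega>)"
      using commute_inv[OF \<alpha> _ perm(1) \<omega>(2)] commute_inv[OF \<alpha> _ perm(2) \<omega>(2)] act_commute[OF a]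
      by auto
    then show ?thesis using act_commute[OF a \<omega>(2)] by (cases i) (simp_all add: \<omega>(1))
  qed
  show "?\<alpha> a v \<in> ?P" if "a \<in> carrier A" "v \<in> ?P" for a v
    using that act_closed by (cases v) simp
  show "?\<alpha> (a \<otimes> b) v = ?\<alpha> a (?\<alpha> b v)" if "a \<in> carrier A" "b \<in> carrier A" "v \<in> ?P" for a b v
    using that act_mult by (cases v) simp
  show "?\<alpha> \<one> v = v" if "v \<in> ?P" for v
    using that act_one by (cases v) simp
  show "a = \<one>" if "a \<in> carrier A" "?\<alpha> a (s, True) = (s, True)" for a
    using that act_free by simp
qed

end

section \<open>Completing a ribbon graph by layers of polygons\<close>

text \<open>
  The input is a ribbon graph with darts \<open>D\<close>: \<open>y\<^sub>0\<close> turns about the vertices, which have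
  degree 3 or 1, and \<open>x\<^sub>0\<close> reverses the edges. It is completed to a map whose faces are all \<open>n\<close>-gons.

  First each dart \<open>d\<close> gets an extra vertex on its edge, with a free dart, always on the same side
  when seen from \<open>d\<close>. On the boundary of the thickened graph there are then exactly four corners from one free dart to
  the next: the two ends, one branch vertex, and one vertex whose free dart is on the other side.
  Next, layers of \<open>n\<close>-gons are added outside. The free dart of a node \<open>\<rho>\<close> is joined to a crown
  vertex in the new layer, and between the crown vertices of \<open>\<rho>\<close> and of its right neighbour the face is
  closed by a path of new vertices, the children of \<open>\<rho>\<close>, each with a new free dart pointing outwards.
  So a node is an original dart with a list of child indices, most recent first.

  \<open>Branch d\<close> is the dart \<open>d\<close> itself. \<open>Lft\<close>, \<open>Rgt\<close> and \<open>Up\<close> are the darts at the vertex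
  of a node, \<open>Up\<close> being the free one; \<open>Down\<close>, \<open>CLft\<close> and \<open>CRgt\<close> are those at its crown vertex.
\<close>

datatype 'd dart =
    Branch 'd
  | Lft "'d \<times> nat list" | Rgt "'d \<times> nat list" | Up "'d \<times> nat list"
  | Down "'d \<times> nat list" | CLft "'d \<times> nat list" | CRgt "'d \<times> nat list"

text \<open>
  A face that meets the old boundary in \<open>m\<close> corners has two more at crown vertices, which leaves
  \<open>n - m - 2\<close> children. Here \<open>m\<close> is 4 for an original dart; it is 3 for a last child, because the run to
  the next free dart passes a crown vertex; and it is 2 otherwise. These numbers are positive exactly when
  \<open>n \<ge> 7\<close>, so the process never gets stuck: this is where hyperbolicity enters.
\<close>

primrec children :: "nat \<Rightarrow> nat list \<Rightarrow> nat" where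
  "children n [] = n - 6"
| "children n (j # js) = (if Suc j = children n js then n - 5 else n - 4)"

primrec address :: "nat \<Rightarrow> nat list \<Rightarrow> bool" where
  "address n [] \<longleftrightarrow> True"
| "address n (j # js) \<longleftrightarrow> j < children n js \<and> address n js"

definition child :: "'d \<times> nat list \<Rightarrow> nat \<Rightarrow> 'd \<times> nat list" where
  "child \<rho> j = (fst \<rho>, j # snd \<rho>)"

definition map_node :: "('d \<Rightarrow> 'e) \<Rightarrow> 'd \<times> nat list \<Rightarrow> 'e \<times> nat list" where
  "map_node \<phi> \<rho> = (\<phi> (fst \<rho>), snd \<rho>)"

lemma map_prod_node: "map_prod \<phi> id = map_node \<phi>"
  by (auto simp: map_node_def fun_eq_iff)

lemma map_node_simps [simp]:
  "map_node \<phi> (d, js) = (\<phi> d, js)" "snd (map_node \<phi> \<rho>) = snd \<rho>"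
  "map_node \<phi> (child \<rho> j) = child (map_node \<phi> \<rho>) j"
  by (simp_all add: map_node_def child_def)

locale ribbon_graph =
  fixes D :: "'d set" and x\<^sub>0 y\<^sub>0 :: "'d \<Rightarrow> 'd" and n :: nat
  assumes x0_closed: "d \<in> D \<Longrightarrow> x\<^sub>0 d \<in> D" and x0_x0: "d \<in> D \<Longrightarrow> x\<^sub>0 (x\<^sub>0 d) = d"
    and y0_closed: "d \<in> D \<Longrightarrow> y\<^sub>0 d \<in> D" and y0_y0_y0: "d \<in> D \<Longrightarrow> y\<^sub>0 (y\<^sub>0 (y\<^sub>0 d)) = d"
    and n_ge_7: "n \<ge> 7"
begin

text \<open>
  Neighbours along the boundary of a layer. From the free dart of an original dart \<open>d\<close> the boundary runs
  to the branch vertex of \<open>d\<close>, then out along the edge of the next dart \<open>y\<^sub>0\<inverse> d\<close>; the free dart on the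
  near side of that edge belongs to its opposite dart. In the later layers, the step past the last child carries over
  to the neighbour of the parent, as in an odometer.
\<close>

fun right :: "'d \<times> nat list \<Rightarrow> 'd \<times> nat list" where
  "right (d, []) = (x\<^sub>0 (y\<^sub>0 (y\<^sub>0 d)), [])"
| "right (d, j # js) =
     (if Suc j < children n js then (d, Suc j # js) else child (right (d, js)) 0)"

abbreviation last_child :: "'d \<times> nat list \<Rightarrow> 'd \<times> nat list" where
  "last_child \<rho> \<equiv> child \<rho> (children n (snd \<rho>) - 1)"

fun left :: "'d \<times> nat list \<Rightarrow> 'd \<times> nat list" where
  "left (d, []) = (y\<^sub>0 (x\<^sub>0 d), [])"
| "left (d, j # js) = (if j > 0 then (d, (j - 1) # js) else last_child (left (d, js)))"

definition nodes :: "('d \<times> nat list) set" where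
  "nodes = D \<times> {js. address n js}"

definition darts :: "'d dart set" where
  "darts = Branch ` D \<union> Lft ` nodes \<union> Rgt ` nodes \<union> Up ` nodes
     \<union> Down ` nodes \<union> CLft ` nodes \<union> CRgt ` nodes"

fun flip :: "'d dart \<Rightarrow> 'd dart" where
  "flip (Branch d) = Rgt (d, [])"
| "flip (Rgt (d, [])) = Branch d"
| "flip (Rgt (d, j # js)) =
     (if Suc j < children n js then Lft (d, Suc j # js) else CLft (right (d, js)))"
| "flip (Lft (d, [])) = Lft (x\<^sub>0 d, [])"
| "flip (Lft (d, 0 # js)) = CRgt (d, js)"
| "flip (Lft (d, Suc j # js)) = Rgt (d, j # js)"
| "flip (Up \<rho>) = Down \<rho>"
| "flip (Down \<rho>) = Up \<rho>"
| "flip (CLft \<rho>) = Rgt (last_child (left \<rho>))"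
| "flip (CRgt \<rho>) = Lft (child \<rho> 0)"

fun turn :: "'d dart \<Rightarrow> 'd dart" where
  "turn (Branch d) = Branch (y\<^sub>0 d)"
| "turn (Rgt \<rho>) = Up \<rho>"
| "turn (Up \<rho>) = Lft \<rho>"
| "turn (Lft \<rho>) = Rgt \<rho>"
| "turn (CRgt \<rho>) = CLft \<rho>"
| "turn (CLft \<rho>) = Down \<rho>"
| "turn (Down \<rho>) = CRgt \<rho>"

lemma children_pos: "children n js > 0"
  using n_ge_7 by (cases js) auto

lemma node_simps [simp]:
  "(d, []) \<in> nodes \<longleftrightarrow> d \<in> D"
  "(d, j # js) \<in> nodes \<longleftrightarrow> (d, js) \<in> nodes \<and> j < children n js"
  "child \<rho> j \<in> nodes \<longleftrightarrow> \<rho> \<in> nodes \<and> j < children n (snd \<rho>)"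
  by (cases \<rho>; auto simp: nodes_def child_def)+

lemma node_induct [consumes 1, case_names root child]:
  assumes "\<rho> \<in> nodes"
    and root: "\<And>d. d \<in> D \<Longrightarrow> Q (d, [])"
    and child: "\<And>\<rho> j. \<rho> \<in> nodes \<Longrightarrow> j < children n (snd \<rho>) \<Longrightarrow> Q \<rho> \<Longrightarrow> Q (child \<rho> j)"
  shows "Q \<rho>"
proof -
  have "(d, js) \<in> nodes \<Longrightarrow> Q (d, js)" for d js
  proof (induction js)
    case (Cons j js)
    then show ?case using child[of "(d, js)" j] by (simp add: child_def)
  qed (simp add: root)
  then show ?thesis using assms(1) by (cases \<rho>) auto
qed

lemma right_child: "right (child \<rho> j) =
    (if Suc j < children n (snd \<rho>) then child \<rho> (Suc j) else child (right \<rho>) 0)"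
  and left_child: "left (child \<rho> j) = (if j > 0 then child \<rho> (j - 1) else last_child (left \<rho>))"
  by (cases \<rho>; simp add: child_def)+

lemma right_left:
  assumes "\<rho> \<in> nodes"
  shows "right \<rho> \<in> nodes \<and> left \<rho> \<in> nodes \<and> left (right \<rho>) = \<rho> \<and> right (left \<rho>) = \<rho>"
  using assms
proof (induction rule: node_induct)
  case (root d)
  then show ?case by (simp add: x0_closed y0_closed x0_x0 y0_y0_y0)
next
  case (child \<rho> j)
  have pos: "children n js > 0" for js by (rule children_pos)
  have "right (child \<rho> j) \<in> nodes" "left (child \<rho> j) \<in> nodes"
    using child pos by (auto simp: right_child left_child)
  moreover have "left (right (child \<rho> j)) = child \<rho> j"
  proof (cases "Suc j < children n (snd \<rho>)")
    case False
    then have "j = children n (snd \<rho>) - 1" using child by simp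
    then show ?thesis using child False by (simp add: right_child left_child)
  next
    case True
    then show ?thesis unfolding right_child if_P[OF True] left_child by simp
  qed
  moreover have "right (left (child \<rho> j)) = child \<rho> j"
  proof (cases "j > 0")
    case True
    then show ?thesis using child unfolding left_child if_P[OF True] right_child by simp
  next
    case False
    have "\<not> Suc (children n (snd (left \<rho>)) - 1) < children n (snd (left \<rho>))" by simp
    then have "right (last_child (left \<rho>)) = child \<rho> 0"
      using child(3) unfolding right_child by simp
    then show ?thesis using False by (simp add: left_child)
  qed
  ultimately show ?case by blast
qed

lemmas right_closed = right_left[THEN conjunct1]
  and left_closed = right_left[THEN conjunct2, THEN conjunct1]
  and left_right = right_left[THEN conjunct2, THEN conjunct2, THEN conjunct1]
  and right_of_left = right_left[THEN conjunct2, THEN conjunct2, THEN conjunct2]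

lemma dart_simps [simp]:
  "Branch d \<in> darts \<longleftrightarrow> d \<in> D" "Lft \<rho> \<in> darts \<longleftrightarrow> \<rho> \<in> nodes" "Rgt \<rho> \<in> darts \<longleftrightarrow> \<rho> \<in> nodes"
  "Up \<rho> \<in> darts \<longleftrightarrow> \<rho> \<in> nodes" "Down \<rho> \<in> darts \<longleftrightarrow> \<rho> \<in> nodes"
  "CLft \<rho> \<in> darts \<longleftrightarrow> \<rho> \<in> nodes" "CRgt \<rho> \<in> darts \<longleftrightarrow> \<rho> \<in> nodes"
  by (auto simp: darts_def)

lemma flip_Rgt_child: "flip (Rgt (child \<rho> j)) =
    (if Suc j < children n (snd \<rho>) then Lft (child \<rho> (Suc j)) else CLft (right \<rho>))"
  and flip_Lft_first: "flip (Lft (child \<rho> 0)) = CRgt \<rho>"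
  and flip_Lft_later: "flip (Lft (child \<rho> (Suc j))) = Rgt (child \<rho> j)"
  by (cases \<rho>; simp add: child_def)+

lemma flip_Lft_child:
  "flip (Lft (child \<rho> j)) = (if j = 0 then CRgt \<rho> else Rgt (child \<rho> (j - 1)))"
  by (cases j) (simp_all add: flip_Lft_first flip_Lft_later)

lemma node_cases:
  assumes "\<rho> \<in> nodes"
  obtains (root) d where "d \<in> D" "\<rho> = (d, [])"
    | (child) \<sigma> j where "\<sigma> \<in> nodes" "j < children n (snd \<sigma>)" "\<rho> = child \<sigma> j"
  using assms by (induction rule: node_induct) auto

lemma flip_flip:
  assumes "\<omega> \<in> darts"
  shows "flip \<omega> \<in> darts \<and> flip (flip \<omega>) = \<omega>"
proof (cases \<omega>)
  case (Lft \<rho>)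
  then have "\<rho> \<in> nodes" using assms by simp
  then show ?thesis unfolding Lft
    by (cases rule: node_cases)
      (auto simp: flip_Lft_child flip_Rgt_child x0_closed x0_x0 simp del: flip.simps(3,5,6))
next
  case (Rgt \<rho>)
  then have "\<rho> \<in> nodes" using assms by simp
  then show ?thesis unfolding Rgt
  proof (cases rule: node_cases)
    case (child \<sigma> j)
    show "flip (Rgt \<rho>) \<in> darts \<and> flip (flip (Rgt \<rho>)) = Rgt \<rho>"
    proof (cases "Suc j < children n (snd \<sigma>)")
      case True
      then show ?thesis using child by (simp add: flip_Rgt_child flip_Lft_later)
    next
      case False
      then have "j = children n (snd \<sigma>) - 1" using child(2) by simp
      then show ?thesis
        using right_closed[OF child(1)] left_right[OF child(1)] child False
        by (simp add: flip_Rgt_child)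
    qed
  qed auto
next
  case (CLft \<rho>)
  then have "\<rho> \<in> nodes" using assms by simp
  then have "left \<rho> \<in> nodes" "right (left \<rho>) = \<rho>"
    using left_closed right_of_left by auto
  then show ?thesis using children_pos[of "snd (left \<rho>)"] by (simp add: CLft flip_Rgt_child)
qed (use assms children_pos in \<open>simp_all add: flip_Lft_first\<close>)

lemma turn_closed: "\<omega> \<in> darts \<Longrightarrow> turn \<omega> \<in> darts"
  and turn_turn_turn: "\<omega> \<in> darts \<Longrightarrow> turn (turn (turn \<omega>)) = \<omega>"
  by (cases \<omega>; simp add: y0_closed y0_y0_y0)+

text \<open>
  The darts with their corner in a given face form a cycle of \<open>flip \<circ> turn\<close>. There is one face for
  each node \<open>\<rho>\<close>: it lies between the outgoing edges of \<open>\<rho>\<close> and of its right neighbour, and the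
  children of \<open>\<rho>\<close> are on its far side.
\<close>

definition along :: "'d dart \<Rightarrow> 'd dart" where
  "along \<omega> = flip (turn \<omega>)"

lemma along_simps:
  "along (Branch d) = Rgt (y\<^sub>0 d, [])" "along (Rgt \<rho>) = Down \<rho>"
  "along (Lft (d, [])) = Branch d" "along (Up (d, [])) = Lft (x\<^sub>0 d, [])"
  "along (Down \<rho>) = Lft (child \<rho> 0)" "along (CLft \<rho>) = Up \<rho>"
  "along (CRgt \<rho>) = Rgt (last_child (left \<rho>))"
  by (simp_all add: along_def)

lemma along_Lft_child: "along (Lft (child \<rho> j)) =
    (if Suc j < children n (snd \<rho>) then Lft (child \<rho> (Suc j)) else CLft (right \<rho>))"
  and along_Up_child:
    "along (Up (child \<rho> j)) = (if j = 0 then CRgt \<rho> else Rgt (child \<rho> (j - 1)))"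
  by (simp_all add: along_def flip_Rgt_child flip_Lft_child)

lemma face_to_child:
  "j < children n (snd \<rho>) \<Longrightarrow> (along ^^ (2 + j)) (Rgt \<rho>) = Lft (child \<rho> j)"
proof (induction j)
  case (Suc j)
  then have "(along ^^ (2 + Suc j)) (Rgt \<rho>) = along (Lft (child \<rho> j))" by simp
  then show ?case using Suc by (simp add: along_Lft_child)
qed (simp add: along_simps numeral_2_eq_2)

lemma face_to_next:
  "(along ^^ (2 + children n (snd \<rho>))) (Rgt \<rho>) = CLft (right \<rho>)"
  "(along ^^ (3 + children n (snd \<rho>))) (Rgt \<rho>) = Up (right \<rho>)"
proof -
  obtain k where k: "children n (snd \<rho>) = Suc k"
    using children_pos[of "snd \<rho>"] by (cases "children n (snd \<rho>)") auto
  have "(along ^^ (2 + Suc k)) (Rgt \<rho>) = along ((along ^^ (2 + k)) (Rgt \<rho>))" by simp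
  also have "\<dots> = CLft (right \<rho>)"
    by (subst face_to_child) (simp_all add: k along_Lft_child)
  finally show 1: "(along ^^ (2 + children n (snd \<rho>))) (Rgt \<rho>) = CLft (right \<rho>)"
    by (simp only: k)
  have "3 + children n (snd \<rho>) = Suc (2 + children n (snd \<rho>))" by simp
  then have "(along ^^ (3 + children n (snd \<rho>))) (Rgt \<rho>)
      = along ((along ^^ (2 + children n (snd \<rho>))) (Rgt \<rho>))"
    by (simp only: funpow.simps o_apply)
  then show "(along ^^ (3 + children n (snd \<rho>))) (Rgt \<rho>) = Up (right \<rho>)"
    by (simp only: 1 along_simps)
qed

lemma face_rest:
  "(along ^^ (i + (3 + children n (snd \<rho>)))) (Rgt \<rho>) = (along ^^ i) (Up (right \<rho>))"
  by (subst funpow_add) (simp only: o_apply face_to_next)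

text \<open>
  After \<open>children + 3\<close> steps the face is back at the old boundary, at the outgoing edge of the right
  neighbour. From there the remaining 3, 2 or 1 steps go back along the boundary.
\<close>

lemma face_closes:
  assumes "\<rho> \<in> nodes"
  shows "(along ^^ n) (Rgt \<rho>) = Rgt \<rho>"
  using assms
proof (cases rule: node_cases)
  case (root d)
  have n: "n = 3 + (3 + children n (snd \<rho>))" using n_ge_7 root by simp
  have "(along ^^ n) (Rgt \<rho>) = (along ^^ 3) (Up (right \<rho>))"
    by (subst n) (rule face_rest)
  then show ?thesis using root
    by (simp add: along_simps numeral_3_eq_3 x0_x0 y0_closed y0_y0_y0)
next
  case (child \<sigma> j)
  show ?thesis
  proof (cases "Suc j = children n (snd \<sigma>)")
    case True
    have n: "n = 2 + (3 + children n (snd \<rho>))" using n_ge_7 child True by (simp add: child_def)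
    have "(along ^^ n) (Rgt \<rho>) = (along ^^ 2) (Up (right \<rho>))"
      by (subst n) (rule face_rest)
    also have "right \<rho> = child (right \<sigma>) 0"
      using True unfolding child(3) right_child by simp
    also have "(along ^^ 2) (Up \<dots>) = Rgt (last_child \<sigma>)"
      using left_right[OF child(1)] by (simp add: along_simps along_Up_child numeral_2_eq_2)
    also have "last_child \<sigma> = \<rho>" using child(3) by (simp flip: True)
    finally show ?thesis .
  next
    case False
    then have lt: "Suc j < children n (snd \<sigma>)" using child by simp
    have n: "n = 1 + (3 + children n (snd \<rho>))" using n_ge_7 child False by (simp add: child_def)
    have "(along ^^ n) (Rgt \<rho>) = (along ^^ 1) (Up (right \<rho>))"
      by (subst n) (rule face_rest)
    also have "right \<rho> = child \<sigma> (Suc j)"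
      using lt unfolding child(3) right_child by simp
    also have "(along ^^ 1) (Up \<dots>) = Rgt \<rho>"
      by (simp add: along_Up_child child(3))
    finally show ?thesis .
  qed
qed

lemma dart_on_face:
  assumes "\<omega> \<in> darts"
  obtains \<rho> i where "\<rho> \<in> nodes" "\<omega> = (along ^^ i) (Rgt \<rho>)"
proof -
  have up: "\<exists>\<rho>\<in>nodes. \<exists>i. \<forall>k. (along ^^ k) (Up \<sigma>) = (along ^^ (k + i)) (Rgt \<rho>)"
    if "\<sigma> \<in> nodes" for \<sigma>
    using that face_rest[of _ "left \<sigma>"] by (metis left_closed right_of_left)
  have "\<exists>\<rho>\<in>nodes. \<exists>i. \<omega> = (along ^^ i) (Rgt \<rho>)"
  proof (cases \<omega>)
    case (Branch d)
    then have "\<omega> = (along ^^ 2) (Up (x\<^sub>0 d, []))" "(x\<^sub>0 d, []) \<in> nodes"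
      using assms by (simp_all add: along_simps numeral_2_eq_2 x0_x0 x0_closed)
    then show ?thesis using up by metis
  next
    case (Lft \<rho>)
    then have "\<rho> \<in> nodes" using assms by simp
    then show ?thesis
    proof (cases rule: node_cases)
      case (root d)
      then have "\<omega> = (along ^^ 1) (Up (x\<^sub>0 d, []))" "(x\<^sub>0 d, []) \<in> nodes"
        using Lft by (simp_all add: along_simps x0_x0 x0_closed)
      then show ?thesis using up by metis
    next
      case (child \<sigma> j)
      then show ?thesis using face_to_child[of j \<sigma>] Lft by metis
    qed
  next
    case (Rgt \<rho>)
    then show ?thesis using assms by (intro bexI[of _ \<rho>] exI[of _ 0]) auto
  next
    case (Up \<rho>)
    then have "\<omega> = (along ^^ 0) (Up \<rho>)" by simp
    then show ?thesis using up[of \<rho>] Up assms by (metis dart_simps(4))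
  next
    case (Down \<rho>)
    then show ?thesis using assms by (intro bexI[of _ \<rho>] exI[of _ 1]) (auto simp: along_simps)
  next
    case (CLft \<rho>)
    then show ?thesis using assms face_to_next(1)[of "left \<rho>"] right_of_left[of \<rho>] left_closed[of \<rho>]
      by (metis dart_simps(6))
  next
    case (CRgt \<rho>)
    then have "\<omega> = (along ^^ 1) (Up (child \<rho> 0))" "child \<rho> 0 \<in> nodes"
      using assms children_pos by (simp_all add: along_Up_child)
    then show ?thesis using up by metis
  qed
  then show ?thesis using that by blast
qed

lemma along_funpow_n:
  assumes "\<omega> \<in> darts"
  shows "(along ^^ n) \<omega> = \<omega>"
proof -
  obtain \<rho> i where \<rho>: "\<rho> \<in> nodes" and \<omega>: "\<omega> = (along ^^ i) (Rgt \<rho>)"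
    using assms by (rule dart_on_face)
  have "(along ^^ n) \<omega> = (along ^^ i) ((along ^^ n) (Rgt \<rho>))"
    unfolding \<omega> by (metis add.commute comp_apply funpow_add)
  then show ?thesis by (simp add: face_closes \<rho> \<omega>)
qed

lemma darts_generated:
  assumes closed: "\<And>\<omega>. \<omega> \<in> S \<Longrightarrow> flip \<omega> \<in> S \<and> turn \<omega> \<in> S"
    and branch: "\<And>d. d \<in> D \<Longrightarrow> Branch d \<in> S"
  shows "darts \<subseteq> S"
proof -
  have flip: "flip \<omega> \<in> S" and turn: "turn \<omega> \<in> S" if "\<omega> \<in> S" for \<omega>
    using closed that by auto
  have all: "Lft \<rho> \<in> S \<and> Rgt \<rho> \<in> S \<and> Up \<rho> \<in> S \<and> Down \<rho> \<in> S \<and> CLft \<rho> \<in> S \<and> CRgt \<rho> \<in> S"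
    if Rgt: "Rgt \<rho> \<in> S" for \<rho>
  proof -
    have Up: "Up \<rho> \<in> S" using turn[OF Rgt] by simp
    have Lft: "Lft \<rho> \<in> S" using turn[OF Up] by simp
    have Down: "Down \<rho> \<in> S" using flip[OF Up] by simp
    have CRgt: "CRgt \<rho> \<in> S" using turn[OF Down] by simp
    have CLft: "CLft \<rho> \<in> S" using turn[OF CRgt] by simp
    show ?thesis using Up Lft Down CRgt CLft Rgt by simp
  qed
  have "Rgt \<rho> \<in> S" if "\<rho> \<in> nodes" for \<rho>
    using that
  proof (induction rule: node_induct)
    case (root d)
    then show ?case using flip[OF branch[of d]] by simp
  next
    case (child \<rho> j)
    from child(2) show ?case
    proof (induction j)
      case 0
      have "CRgt \<rho> \<in> S" using all child(3) by simp
      from turn[OF flip[OF this]] show ?case by simp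
    next
      case (Suc j)
      then have "Rgt (child \<rho> j) \<in> S" by simp
      from turn[OF flip[OF this]] show ?case using Suc(2) by (simp add: flip_Rgt_child)
    qed
  qed
  then show ?thesis using all branch by (auto simp: darts_def)
qed

text \<open>
  The completion has added only vertices of degree 3, so that the leaves of the ribbon graph can still
  be recognised.
\<close>

lemma turn_fixed_iff:
  "turn \<omega> = \<omega> \<longleftrightarrow> (\<exists>d. \<omega> = Branch d \<and> y\<^sub>0 d = d)"
  by (cases \<omega>) auto

text \<open>The completion is functorial: symmetries of the ribbon graph extend to the map.\<close>

context
  fixes \<phi> :: "'d \<Rightarrow> 'd"
  assumes \<phi>_closed: "\<And>d. d \<in> D \<Longrightarrow> \<phi> d \<in> D"
    and \<phi>_x0: "\<And>d. d \<in> D \<Longrightarrow> \<phi> (x\<^sub>0 d) = x\<^sub>0 (\<phi> d)"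
    and \<phi>_y0: "\<And>d. d \<in> D \<Longrightarrow> \<phi> (y\<^sub>0 d) = y\<^sub>0 (\<phi> d)"
begin

lemma map_right_left:
  assumes "\<rho> \<in> nodes"
  shows "map_node \<phi> (right \<rho>) = right (map_node \<phi> \<rho>)
    \<and> map_node \<phi> (left \<rho>) = left (map_node \<phi> \<rho>)"
  using assms
proof (induction rule: node_induct)
  case (root d)
  then show ?case by (simp add: \<phi>_x0 \<phi>_y0 x0_closed y0_closed)
next
  case (child \<rho> j)
  then have "snd (left (map_node \<phi> \<rho>)) = snd (left \<rho>)"
    by (metis map_node_simps(2))
  with child(3) show ?case by (simp add: right_child left_child)
qed

lemma map_dart_closed: "\<omega> \<in> darts \<Longrightarrow> map_dart \<phi> \<omega> \<in> darts"
  by (cases \<omega>) (auto simp: map_prod_node map_node_def \<phi>_closed nodes_def)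

lemma map_dart_turn: "\<omega> \<in> darts \<Longrightarrow> map_dart \<phi> (turn \<omega>) = turn (map_dart \<phi> \<omega>)"
  by (cases \<omega>) (auto simp: \<phi>_y0 map_prod_node)

lemma map_dart_flip:
  assumes "\<omega> \<in> darts"
  shows "map_dart \<phi> (flip \<omega>) = flip (map_dart \<phi> \<omega>)"
proof (cases \<omega>)
  case (Lft \<rho>)
  then have "\<rho> \<in> nodes" using assms by simp
  then show ?thesis unfolding Lft
    by (cases rule: node_cases) (auto simp: \<phi>_x0 map_prod_node flip_Lft_child)
next
  case (Rgt \<rho>)
  then have "\<rho> \<in> nodes" using assms by simp
  then show ?thesis unfolding Rgt
    by (cases rule: node_cases) (auto simp: map_prod_node flip_Rgt_child map_right_left)
next
  case (CLft \<rho>)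
  then have "\<rho> \<in> nodes" using assms by simp
  then have "map_node \<phi> (left \<rho>) = left (map_node \<phi> \<rho>)" using map_right_left by blast
  moreover from this have "snd (left \<rho>) = snd (left (map_node \<phi> \<rho>))"
    by (metis map_node_simps(2))
  ultimately show ?thesis unfolding CLft by (simp add: map_prod_node)
qed (auto simp: map_prod_node)

end

end

section \<open>A chiral ribbon graph with a given countable group of symmetries\<close>

text \<open>
  The ribbon graph is a covering with group \<open>A\<close> of a comb. Its base graph is a ray whose vertex \<open>i\<close> has
  darts \<open>Prev i\<close>, \<open>Next i\<close>, \<open>Stem i\<close>. The stem of vertex \<open>i + 1\<close> leads to a vertex with darts \<open>Root i\<close>,
  \<open>LoopOut i\<close>, \<open>LoopIn i\<close>, and the loop there carries the voltage \<open>g i\<close>: going round it changes the sheet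
  from \<open>a\<close> to \<open>a \<otimes> g i\<close>. As the voltages exhaust \<open>A\<close>, the covering is connected; the infinite ray provides room
  for countably many loops.

  The start of the ray carries the markings. \<open>Leaf\<close> is the only dart fixed by \<open>spin\<close>, and
  \<open>Stem 0\<close> the only one fixed by \<open>edge\<close>. Seen from the leaf, the marked stem is on one
  definite side of the ray.
\<close>

datatype station =
  Leaf | Prev nat | Next nat | Stem nat | Root nat | LoopOut nat | LoopIn nat

locale voltage_comb = group A for A :: "('a, 'm) monoid_scheme" (structure) +
  fixes g :: "nat \<Rightarrow> 'a" and n :: nat
  assumes g_onto: "range g = carrier A" and n_ge_7: "n \<ge> 7"
begin

fun edge :: "'a \<times> station \<Rightarrow> 'a \<times> station" where
  "edge (a, Leaf) = (a, Prev 0)"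
| "edge (a, Prev 0) = (a, Leaf)"
| "edge (a, Prev (Suc i)) = (a, Next i)"
| "edge (a, Next i) = (a, Prev (Suc i))"
| "edge (a, Stem 0) = (a, Stem 0)"
| "edge (a, Stem (Suc i)) = (a, Root i)"
| "edge (a, Root i) = (a, Stem (Suc i))"
| "edge (a, LoopOut i) = (a \<otimes> g i, LoopIn i)"
| "edge (a, LoopIn i) = (a \<otimes> inv g i, LoopOut i)"

fun spin :: "'a \<times> station \<Rightarrow> 'a \<times> station" where
  "spin (a, Leaf) = (a, Leaf)"
| "spin (a, Prev i) = (a, Next i)"
| "spin (a, Next i) = (a, Stem i)"
| "spin (a, Stem i) = (a, Prev i)"
| "spin (a, Root i) = (a, LoopOut i)"
| "spin (a, LoopOut i) = (a, LoopIn i)"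
| "spin (a, LoopIn i) = (a, Root i)"

lemma g_closed [simp]: "g i \<in> carrier A"
  using g_onto by auto

sublocale ribbon_graph "carrier A \<times> (UNIV :: station set)" edge spin n
proof
  show "edge d \<in> carrier A \<times> UNIV" if "d \<in> carrier A \<times> UNIV" for d
    using that by (cases d rule: edge.cases) auto
  show "edge (edge d) = d" if "d \<in> carrier A \<times> UNIV" for d
    using that by (cases d rule: edge.cases) (auto simp: m_assoc)
  show "spin d \<in> carrier A \<times> UNIV" "spin (spin (spin d)) = d" if "d \<in> carrier A \<times> UNIV" for d
    using that by (cases d rule: spin.cases; simp)+
qed (rule n_ge_7)

lemma graph_connected:
  assumes base: "(\<one>, Leaf) \<in> S"
    and closed: "\<And>d. d \<in> S \<Longrightarrow> edge d \<in> S \<and> spin d \<in> S"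
  shows "carrier A \<times> UNIV \<subseteq> S"
proof -
  have edge: "edge d \<in> S" and spin: "spin d \<in> S" if "d \<in> S" for d
    using closed that by auto
  have row: "{(a, Prev i), (a, Next i), (a, Stem i)} \<subseteq> S" if "(a, Prev i) \<in> S" for a i
    using that spin[OF that] spin[OF spin[OF that]] by simp
  have comb: "{(a, Prev i), (a, Next i), (a, Stem i), (a, Root i), (a, LoopOut i), (a, LoopIn i)} \<subseteq> S"
    if a: "(a, Leaf) \<in> S" for a i
  proof -
    have prev: "(a, Prev i) \<in> S" for i
    proof (induction i)
      case 0
      show ?case using edge[OF a] by simp
    next
      case (Suc i)
      then have "(a, Next i) \<in> S" using row by simp
      from edge[OF this] show ?case by simp
    qed
    have "(a, Stem (Suc i)) \<in> S" using row prev by simp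
    from edge[OF this] have root: "(a, Root i) \<in> S" by simp
    show ?thesis
      using row[OF prev] root spin[OF root] spin[OF spin[OF root]] by simp
  qed
  have to_leaf: "(a, Leaf) \<in> S" if "(a, Prev i) \<in> S" for a i
    using that
  proof (induction i)
    case 0
    from edge[OF 0] show ?case by simp
  next
    case (Suc i)
    from spin[OF spin[OF edge[OF Suc.prems]]] show ?case by (intro Suc.IH) simp
  qed
  have leaf: "(a, Leaf) \<in> S" if a: "a \<in> carrier A" for a
  proof -
    obtain i where i: "g i = a" using g_onto a by (metis imageE)
    have "(\<one>, LoopOut i) \<in> S" using comb[OF base] by simp
    from edge[OF this] have "(a, LoopIn i) \<in> S" by (simp add: i a)
    from edge[OF spin[OF this]] have "(a, Stem (Suc i)) \<in> S" by simp
    from spin[OF this] show ?thesis by (intro to_leaf) simp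
  qed
  have "(a, t) \<in> S" if "a \<in> carrier A" for a t
    using comb[OF leaf[OF that]] leaf[OF that] by (cases t) simp_all
  then show ?thesis by auto
qed

text \<open>Voltages multiply on the right, so left multiplication permutes the sheets.\<close>

definition shift :: "'a \<Rightarrow> 'a \<times> station \<Rightarrow> 'a \<times> station" where
  "shift a d = (a \<otimes> fst d, snd d)"

lemma shift_commutes:
  assumes "a \<in> carrier A" "d \<in> carrier A \<times> UNIV"
  shows "shift a d \<in> carrier A \<times> UNIV" "shift a (edge d) = edge (shift a d)"
    "shift a (spin d) = spin (shift a d)"
proof -
  show "shift a d \<in> carrier A \<times> UNIV" using assms by (auto simp: shift_def)
  show "shift a (edge d) = edge (shift a d)"
    using assms by (cases d rule: edge.cases) (auto simp: shift_def m_assoc)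
  show "shift a (spin d) = spin (shift a d)"
    using assms by (cases d rule: spin.cases) (auto simp: shift_def)
qed

abbreviation base_dart :: "('a \<times> station) dart" where
  "base_dart \<equiv> Branch (\<one>, Leaf)"

lemma turn_fixed: "\<omega> \<in> darts \<Longrightarrow> turn \<omega> = \<omega> \<Longrightarrow> \<exists>a\<in>carrier A. \<omega> = Branch (a, Leaf)"
  unfolding turn_fixed_iff by (auto elim!: spin.elims)

text \<open>
  A map \<open>h\<close> to the mirror image sends the base leaf to a leaf, since leaves are the fixed
  points of \<open>turn\<close>. The walk from the leaf to the edge of the stem \<open>Stem 0\<close>, which \<open>flip\<close> fixes,
  is taken by \<open>h\<close> to the walk with all turns reversed. Where the first turn of the original continues along
  the edge, the image turns to the free dart and so leaves the ribbon graph; it ends at a dart which \<open>flip\<close>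
  moves.
\<close>

lemma no_mirror:
  assumes h: "h \<in> darts \<rightarrow> darts"
    and rev: "\<And>\<omega>. \<omega> \<in> darts \<Longrightarrow> flip (h (flip \<omega>)) = h \<omega> \<and> turn (h (turn \<omega>)) = h \<omega>"
  shows False
proof -
  have flip: "h (flip \<omega>) = flip (h \<omega>)" if "\<omega> \<in> darts" for \<omega>
    using rev[OF that] flip_flip that h by (metis PiE)
  have turn: "h (turn \<omega>) = turn (turn (h \<omega>))" if "\<omega> \<in> darts" for \<omega>
    using rev[OF that] turn_turn_turn turn_closed that h by (metis PiE)
  have turn_back: "h (turn (turn \<omega>)) = turn (h \<omega>)" if "\<omega> \<in> darts" for \<omega>
    using turn[OF turn_closed[OF that]] turn[OF that] turn_turn_turn that h by (metis PiE)
  have "h base_dart \<in> darts" using h by (rule funcset_mem) simp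
  moreover have "turn (h base_dart) = h base_dart"
    using rev[of base_dart] by simp
  ultimately obtain a where a: "a \<in> carrier A" and start: "h base_dart = Branch (a, Leaf)"
    using turn_fixed by blast
  define \<sigma> where "\<sigma> = last_child (left ((a, Leaf), []))"
  have 1: "h (Rgt ((\<one>, Leaf), [])) = Rgt ((a, Leaf), [])"
    using flip[of base_dart] start by simp
  have 2: "h (Lft ((\<one>, Leaf), [])) = Up ((a, Leaf), [])"
    using turn_back[of "Rgt ((\<one>, Leaf), [])"] 1 by simp
  have 3: "h (Lft ((\<one>, Prev 0), [])) = Down ((a, Leaf), [])"
    using flip[of "Lft ((\<one>, Leaf), [])"] 2 by simp
  have 4: "h (Rgt ((\<one>, Prev 0), [])) = CLft ((a, Leaf), [])"
    using turn[of "Lft ((\<one>, Prev 0), [])"] 3 by simp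
  have 5: "h (Branch (\<one>, Prev 0)) = Rgt \<sigma>"
    using flip[of "Rgt ((\<one>, Prev 0), [])"] 4 by (simp add: \<sigma>_def)
  have 6: "h (Branch (\<one>, Stem 0)) = Up \<sigma>"
    using turn_back[of "Branch (\<one>, Prev 0)"] 5 by simp
  have 7: "h (Rgt ((\<one>, Stem 0), [])) = Down \<sigma>"
    using flip[of "Branch (\<one>, Stem 0)"] 6 by simp
  have 8: "h (Lft ((\<one>, Stem 0), [])) = CRgt \<sigma>"
    using turn_back[of "Rgt ((\<one>, Stem 0), [])"] 7 by simp
  have "h (Lft ((\<one>, Stem 0), [])) = flip (CRgt \<sigma>)"
    using flip[of "Lft ((\<one>, Stem 0), [])"] 8 by simp
  with 8 show False by simp
qed

lemma map_dart_cong: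
  "\<omega> \<in> darts \<Longrightarrow> (\<And>d. d \<in> carrier A \<times> UNIV \<Longrightarrow> \<phi> d = \<psi> d) \<Longrightarrow> map_dart \<phi> \<omega> = map_dart \<psi> \<omega>"
  by (cases \<omega>) (auto simp: map_prod_node map_node_def nodes_def)

text \<open>Fixing everything else makes a permutation of the darts a permutation of the whole type.\<close>

definition on_darts where
  "on_darts f = override_on id f darts"

lemma on_darts_in: "\<omega> \<in> darts \<Longrightarrow> on_darts f \<omega> = f \<omega>"
  and on_darts_notin: "\<omega> \<notin> darts \<Longrightarrow> on_darts f \<omega> = \<omega>"
  by (simp_all add: on_darts_def)

lemma on_darts_permutes:
  assumes "\<And>\<omega>. \<omega> \<in> darts \<Longrightarrow> f \<omega> \<in> darts" "\<And>\<omega>. \<omega> \<in> darts \<Longrightarrow> f' \<omega> \<in> darts"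
    and "\<And>\<omega>. \<omega> \<in> darts \<Longrightarrow> f (f' \<omega>) = \<omega>" "\<And>\<omega>. \<omega> \<in> darts \<Longrightarrow> f' (f \<omega>) = \<omega>"
  shows "on_darts f permutes darts"
proof (rule bij_imp_permutes)
  show "bij_betw (on_darts f) darts darts"
    by (rule bij_betw_byWitness[of _ f']) (use assms in \<open>auto simp: on_darts_in\<close>)
qed (simp add: on_darts_notin)

text \<open>
  The base point is a leaf, hence fixed by \<open>y\<close>; an equivariant map sends it to another fixed point of
  \<open>y\<close>, and the leaves are exactly the translates of the base point under \<open>A\<close>. This is rigidity.
\<close>

theorem comb_triangle_system:
  defines "x \<equiv> on_darts flip" and "y \<equiv> on_darts turn"
  defines "z \<equiv> inv_fun y \<circ> inv_fun x"
  shows "triangle_system A 2 3 n darts x y z (\<lambda>a. map_dart (shift a)) base_dart"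
proof -
  have x_in: "x \<omega> = flip \<omega>" and y_in: "y \<omega> = turn \<omega>" if "\<omega> \<in> darts" for \<omega>
    using that by (simp_all add: x_def y_def on_darts_in)
  have x_out: "x \<omega> = \<omega>" and y_out: "y \<omega> = \<omega>" if "\<omega> \<notin> darts" for \<omega>
    using that by (simp_all add: x_def y_def on_darts_notin)
  have x_perm: "x permutes darts"
    unfolding x_def by (rule on_darts_permutes[of _ flip]) (use flip_flip in auto)
  have y_perm: "y permutes darts"
    unfolding y_def
    by (rule on_darts_permutes[of _ "\<lambda>\<omega>. turn (turn \<omega>)"]) (use turn_closed turn_turn_turn in auto)
  have z_perm: "z permutes darts"
    unfolding z_def by (intro permutes_compose permutes_inv x_perm y_perm)
  have xx: "x (x \<omega>) = \<omega>" and yyy: "y (y (y \<omega>)) = \<omega>" for \<omega>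
    using flip_flip[of \<omega>] turn_turn_turn[of \<omega>] turn_closed
    by (cases "\<omega> \<in> darts"; simp add: x_in y_in x_out y_out)+
  have xy: "((x \<circ> y) ^^ k) \<omega> = (along ^^ k) \<omega> \<and> (along ^^ k) \<omega> \<in> darts" if "\<omega> \<in> darts" for k \<omega>
    using that by (induction k) (auto simp: x_in y_in along_def turn_closed flip_flip)
  have "(x \<circ> y) ^^ n = id"
  proof
    fix \<omega>
    show "((x \<circ> y) ^^ n) \<omega> = id \<omega>"
    proof (cases "\<omega> \<in> darts")
      case True
      then show ?thesis using xy along_funpow_n by simp
    next
      case False
      have "((x \<circ> y) ^^ k) \<omega> = \<omega>" for k
        by (induction k) (use False in \<open>simp_all add: x_out y_out\<close>)
      then show ?thesis by simp
    qed
  qed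
  moreover have "bij (x \<circ> y)" using x_perm y_perm by (intro bij_comp permutes_bij)
  ultimately have "inv_fun (x \<circ> y) ^^ n = id" by (simp flip: inv_fn)
  moreover have z: "z = inv_fun (x \<circ> y)"
    unfolding z_def using x_perm y_perm by (simp add: o_inv_distrib permutes_bij)
  ultimately have zn: "z ^^ n = id" by simp
  have shifts: "\<And>d. d \<in> carrier A \<times> UNIV \<Longrightarrow> shift a d \<in> carrier A \<times> UNIV"
    "\<And>d. d \<in> carrier A \<times> UNIV \<Longrightarrow> shift a (edge d) = edge (shift a d)"
    "\<And>d. d \<in> carrier A \<times> UNIV \<Longrightarrow> shift a (spin d) = spin (shift a d)"
    if "a \<in> carrier A" for a
    by (rule shift_commutes[OF that]; assumption)+
  show ?thesis
  proof unfold_locales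
    show "x permutes darts" "y permutes darts" "z permutes darts" by (fact x_perm y_perm z_perm)+
    show "x ^^ 2 = id" "y ^^ 3 = id" "z ^^ n = id"
      using xx yyy zn by (auto simp: numeral_2_eq_2 numeral_3_eq_3)
    show "x \<circ> y \<circ> z = id"
      unfolding z using x_perm y_perm by (intro surj_iff[THEN iffD1] bij_is_surj bij_comp permutes_bij)
    show "base_dart \<in> darts" by simp
    show "darts \<subseteq> S" if base: "base_dart \<in> S" and
      closed: "\<And>\<omega>. \<omega> \<in> S \<Longrightarrow> {x \<omega>, y \<omega>, z \<omega>, inv_fun x \<omega>, inv_fun y \<omega>, inv_fun z \<omega>} \<subseteq> S" for S
    proof -
      let ?S = "S \<inter> darts"
      have gens: "flip \<omega> \<in> ?S \<and> turn \<omega> \<in> ?S" if "\<omega> \<in> ?S" for \<omega>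
        using closed[of \<omega>] that x_in[of \<omega>] y_in[of \<omega>] flip_flip[of \<omega>] turn_closed[of \<omega>] by auto
      have "carrier A \<times> UNIV \<subseteq> {d. Branch d \<in> ?S}"
      proof (rule graph_connected)
        fix d assume d: "d \<in> {d. Branch d \<in> ?S}"
        then have "Branch (spin d) \<in> ?S" using gens[of "Branch d"] by simp
        moreover have "Rgt (d, []) \<in> ?S" using d gens[of "Branch d"] by simp
        then have "turn (turn (Rgt (d, []))) \<in> ?S" using gens by blast
        then have "Branch (edge d) \<in> ?S"
          using gens[of "Lft (d, [])"] gens[of "Lft (edge d, [])"] gens[of "Rgt (edge d, [])"] by simp
        ultimately show "edge d \<in> {d. Branch d \<in> ?S} \<and> spin d \<in> {d. Branch d \<in> ?S}" by simp
      qed (use base in simp)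
      then have "darts \<subseteq> ?S" using gens by (intro darts_generated) auto
      then show ?thesis by simp
    qed
    show act: "map_dart (shift a) \<omega> \<in> darts" if "a \<in> carrier A" "\<omega> \<in> darts" for a \<omega>
      using map_dart_closed[OF shifts[OF that(1)]] that(2) by blast
    show "map_dart (shift (a \<otimes> b)) \<omega> = map_dart (shift a) (map_dart (shift b) \<omega>)"
      if "a \<in> carrier A" "b \<in> carrier A" "\<omega> \<in> darts" for a b \<omega>
      unfolding dart.map_comp
      by (rule map_dart_cong) (use that in \<open>auto simp: shift_def m_assoc\<close>)
    show "map_dart (shift \<one>) \<omega> = \<omega>" if "\<omega> \<in> darts" for \<omega>
    proof -
      have "map_dart (shift \<one>) \<omega> = map_dart id \<omega>"
        by (rule map_dart_cong) (use that in \<open>auto simp: shift_def\<close>)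
      then show ?thesis by (simp add: dart.map_id)
    qed
    show "map_dart (shift a) (x \<omega>) = x (map_dart (shift a) \<omega>) \<and>
        map_dart (shift a) (y \<omega>) = y (map_dart (shift a) \<omega>) \<and>
        map_dart (shift a) (z \<omega>) = z (map_dart (shift a) \<omega>)"
      if a: "a \<in> carrier A" and \<omega>: "\<omega> \<in> darts" for a \<omega>
    proof -
      have x: "map_dart (shift a) (x \<nu>) = x (map_dart (shift a) \<nu>)"
        and y: "map_dart (shift a) (y \<nu>) = y (map_dart (shift a) \<nu>)" if \<nu>: "\<nu> \<in> darts" for \<nu>
        using map_dart_flip[OF shifts[OF a] \<nu>] map_dart_turn[OF shifts[OF a] \<nu>] act[OF a \<nu>] \<nu>
        by (simp_all add: x_in y_in)
      have "y \<nu> \<in> darts" if "\<nu> \<in> darts" for \<nu> using that y_perm by (simp add: permutes_in_image)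
      then have "map_dart (shift a) ((x \<circ> y) \<nu>) = (x \<circ> y) (map_dart (shift a) \<nu>)"
        if "\<nu> \<in> darts" for \<nu> using that x y by simp
      moreover have "x \<circ> y permutes darts" by (rule permutes_compose[OF y_perm x_perm])
      moreover have "map_dart (shift a) \<in> darts \<rightarrow> darts" using act[OF a] by blast
      ultimately have "map_dart (shift a) (z \<omega>) = z (map_dart (shift a) \<omega>)"
        unfolding z using \<omega> by (intro commute_inv[of _ darts])
      then show ?thesis using x y \<omega> by simp
    qed
    show "a = \<one>" if "a \<in> carrier A" "map_dart (shift a) base_dart = base_dart" for a
      using that by (simp add: shift_def)
    show "\<exists>a\<in>carrier A. h base_dart = map_dart (shift a) base_dart"
      if h: "h \<in> darts \<rightarrow> darts" and comm: "\<And>\<omega>. \<omega> \<in> darts \<Longrightarrow>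
        h (x \<omega>) = x (h \<omega>) \<and> h (y \<omega>) = y (h \<omega>) \<and> h (z \<omega>) = z (h \<omega>)" for h
    proof -
      have base: "base_dart \<in> darts" by simp
      then have "h base_dart \<in> darts" using h by blast
      moreover have "turn (h base_dart) = h base_dart"
        using comm[OF base] y_in[OF base] y_in[OF \<open>h base_dart \<in> darts\<close>] by simp
      ultimately obtain a where "a \<in> carrier A" "h base_dart = Branch (a, Leaf)"
        using turn_fixed by blast
      then show ?thesis by (intro bexI[of _ a]) (simp_all add: shift_def)
    qed
    show False if h: "h \<in> darts \<rightarrow> darts" and rev: "\<And>\<omega>. \<omega> \<in> darts \<Longrightarrow>
        x (h (x \<omega>)) = h \<omega> \<and> y (h (y \<omega>)) = h \<omega>" for h
    proof (rule no_mirror[OF h])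
      fix \<omega> assume \<omega>: "\<omega> \<in> darts"
      then have "h (flip \<omega>) \<in> darts" "h (turn \<omega>) \<in> darts" using h flip_flip turn_closed by blast+
      then show "flip (h (flip \<omega>)) = h \<omega> \<and> turn (h (turn \<omega>)) = h \<omega>"
        using rev[OF \<omega>] \<omega> by (simp add: x_in y_in)
    qed
  qed
qed

end

section \<open>Realisation in all triangle groups of the given types\<close>

lemma countable_group_triangle_system:
  fixes A :: "'a monoid"
  assumes "group A" "countable (carrier A)" "n \<ge> 7"
  obtains P :: "('a \<times> station) dart set" and x y z \<alpha> s where "triangle_system A 2 3 n P x y z \<alpha> s"
proof -
  interpret group A by fact
  have "range (from_nat_into (carrier A)) = carrier A"
    using assms(2) one_closed by (intro range_from_nat_into) auto
  then have "voltage_comb A (from_nat_into (carrier A)) n"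
    using assms by (simp add: voltage_comb_def voltage_comb_axioms_def)
  from voltage_comb.comb_triangle_system[OF this] show ?thesis by (rule that)
qed

theorem proposition20:
  fixes p q r :: nat
  assumes "p > 0" "q > 0" "r > 0"
    and "\<exists>a b c. {#a, b, c#} = {#p, q, r#} \<and> even a \<and> 3 dvd b \<and> c \<ge> 7"
  shows "group_countable_realisation TYPE('a) (triangle_group p q r)
       \<and> group_countable_realisation TYPE('a) (extended_triangle_group p q r)
       \<and> category_countable_realisation TYPE('a) (oriented_hypermaps p q r)
       \<and> category_countable_realisation TYPE('a) (all_hypermaps p q r)"
proof -
  obtain a b c where abc: "{#a, b, c#} = {#p, q, r#}" "even a" "3 dvd b" "c \<ge> 7"
    using assms(4) by blast
  have perms: "(p, q, r) = (a, b, c) \<or> (p, q, r) = (a, c, b) \<or> (p, q, r) = (b, a, c) \<or>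
      (p, q, r) = (b, c, a) \<or> (p, q, r) = (c, a, b) \<or> (p, q, r) = (c, b, a)"
    using abc(1) by (auto simp: add_eq_conv_ex)
  have system: "\<exists>(P :: ('a \<times> station) dart set) x y z \<alpha> s. triangle_system A p q r P x y z \<alpha> s"
    if A: "group A" "countable (carrier A)" for A :: "'a monoid"
  proof -
    obtain P :: "('a \<times> station) dart set" and x y z \<alpha> s where "triangle_system A 2 3 c P x y z \<alpha> s"
      using countable_group_triangle_system[OF A abc(4)] .
    then have abc': "triangle_system A a b c P x y z \<alpha> s"
      using triangle_system.multiples[of A 2 3 c P x y z \<alpha> s a b c] abc by simp
    note bca = triangle_system.rotate[OF abc']
    note cab = triangle_system.rotate[OF bca]
    note bac = triangle_system.reflect[OF abc'] 
    note acb = triangle_system.rotate[OF bac]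
    note cba = triangle_system.rotate[OF acb]
    from perms show ?thesis
      by (elim disjE; simp) (use abc' acb bac bca cab cba in blast)+
  qed
  have rot: "group_countable_realisation TYPE('a) (triangle_group p q r)"
    unfolding group_countable_realisation_def
  proof (intro allI impI, elim conjE)
    fix A :: "'a monoid" assume "group A" "countable (carrier A)"
    from system[OF this] show "\<exists>M. subgroup M (triangle_group p q r) \<and>
        A \<cong> triangle_group p q r\<lparr>carrier := normalizer (triangle_group p q r) M\<rparr> Mod M"
      by (elim exE) (rule triangle_system.triangle_group_realises)
  qed
  have ref: "group_countable_realisation TYPE('a) (extended_triangle_group p q r)"
    unfolding group_countable_realisation_def
  proof (intro allI impI, elim conjE)
    fix A :: "'a monoid" assume "group A" "countable (carrier A)"
    from system[OF this] show "\<exists>M. subgroup M (extended_triangle_group p q r) \<and>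
        A \<cong> extended_triangle_group p q r\<lparr>carrier := normalizer (extended_triangle_group p q r) M\<rparr> Mod M"
      by (elim exE) (rule triangle_system.extended_triangle_group_realises)
  qed
  have "group (triangle_group p q r)" "group (extended_triangle_group p q r)"
    by (simp_all add: triangle_group_def extended_triangle_group_def group_presented_group)
  note category_realisation_if_group_realisation[OF this(1) rot]
    category_realisation_if_group_realisation[OF this(2) ref]
  then show ?thesis
    using rot ref unfolding oriented_hypermaps_def all_hypermaps_def by simp
qed

end
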